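(* For any $r>0$: (i) $N(B_p(r))=B_p^o(r)$; (ii) $O(B_p(r))=S_p(r)$; (iii) furthermore, for any $g\in S_p(r)$: (a) $\mathcal{S}_{B_p(r)}^{-1}(g)=\{tJ_p(g):0\le t<\infty\}$; (b) $\mathcal{S}_{B_p(r)}^{-*}(g)$ is a curve in $L_p(S;X)$ with ending point at $\theta$ and passing through $g$.
   Context: Setting: $(S,\mathcal{A},\mu)$ is a positive complete measure space, $(X,\|\cdot\|_X)$ is a real uniformly convex and uniformly smooth Banach space with dual $X^*$, and $1<p,q<\infty$ with $\frac1p+\frac1q=1$. $L_p(S;X)$ is the Bochner space of ($\mu$-equivalence classes of) strongly $\mu$-measurable $f:S\to X$ with $\|f\|_{L_p(S;X)}=\left(\int_S\|f(s)\|_X^p\,d\mu(s)\right)^{1/p}<\infty$; it is uniformly convex and uniformly smooth with dual $L_q(S;X^* )$ under the pairing $\langle\varphi,f\rangle=\int_S\langle\varphi(s),f(s)\rangle\,d\mu(s)$. The origins of $L_p(S;X)$ and $L_q(S;X^* )$ are $\theta$ and $\theta^*$. Normalized duality mapping: $J_p:L_p(S;X)\to L_q(S;X^* )$ is the single-valued mapping determined by $\langle J_pf,f\rangle=\|J_pf\|_{L_q(S;X^* )}\|f\|_{L_p(S;X)}=\|f\|_{L_p(S;X)}^2=\|J_pf\|_{L_q(S;X^* )}^2$. $B_p(r)$, $B_p^o(r)$, $S_p(r)$ are the closed ball, open ball and sphere in $L_p(S;X)$ with center $\theta$ and radius $r$. For a nonempty closed convex $C\subseteq L_p(S;X)$ and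 $g\in C$, $$\mathcal{S}_C^{-1}(g)=\left\{\varphi\in L_q(S;X^* ):\ \langle\varphi,g\rangle=\sup_{f\in C}\langle\varphi,f\rangle\right\},\qquad \mathcal{S}_C^{-*}(g)=\left\{h\in L_p(S;X):\ \langle J_ph,g\rangle=\sup_{f\in C}\langle J_ph,f\rangle\right\}.$$ (One always has $\theta^*\in\mathcal{S}_C^{-1}(g)$.) The point $g\in C$ is optimal if $\mathcal{S}_C^{-1}(g)\supsetneq\{\theta^*\}$ and none-optimal otherwise; $O(C)$ is the set of optimal points of $C$ and $N(C)$ the set of none-optimal points of $C$. A curve with ending point at $\theta$ and through $g$ means the image of a continuous map $\gamma:[0,\infty)\to L_p(S;X)$ with $\gamma(0)=\theta$ and $g$ in the image. *)

theory Defs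
  imports "HOL-Analysis.Analysis"
begin

section \<open>Uniform convexity and uniform smoothness\<close>

definition uniformly_convex :: "'b::real_normed_vector itself \<Rightarrow> bool" where
  "uniformly_convex _ \<longleftrightarrow>
     (\<forall>\<epsilon>>0. \<exists>\<delta>>0. \<forall>x y :: 'b.
        norm x = 1 \<longrightarrow> norm y = 1 \<longrightarrow> norm (x - y) \<ge> \<epsilon> \<longrightarrow> norm ((1/2) *\<^sub>R (x + y)) \<le> 1 - \<delta>)"

definition uniformly_smooth :: "'b::real_normed_vector itself \<Rightarrow> bool" where
  "uniformly_smooth _ \<longleftrightarrow>
     (\<forall>\<epsilon>>0. \<exists>\<delta>>0. \<forall>x y :: 'b.
        norm x = 1 \<longrightarrow> norm y \<le> \<delta> \<longrightarrow> norm (x + y) + norm (x - y) \<le> 2 + \<epsilon> * norm y)"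


section \<open>Bochner spaces\<close>

text \<open>The value space may be non-separable, so Borel measurability does not suffice. The library's
  \<open>simple_bochner_integrable\<close> functions are the measurable functions with finitely many
  values that vanish outside a set of finite measure.\<close>

definition strongly_measurable :: "'a measure \<Rightarrow> ('a \<Rightarrow> 'b::real_normed_vector) \<Rightarrow> bool" where
  "strongly_measurable M f \<longleftrightarrow>
     (\<exists>u :: nat \<Rightarrow> 'a \<Rightarrow> 'b. (\<forall>i. Bochner_Integration.simple_bochner_integrable M (u i)) \<and>
        (AE s in M. (\<lambda>i. u i s) \<longlonglongrightarrow> f s))"

text \<open>Elements of a Bochner space are represented as equivalence classes, i.e. sets of functions.
  Values outside \<open>space M\<close> are irrelevant for almost-everywhere equality, so a class
  contains every extension of its functions from \<open>space M\<close> to the whole type.\<close>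

definition ae_eq :: "'a measure \<Rightarrow> (('a \<Rightarrow> 'b) \<times> ('a \<Rightarrow> 'b)) set" where
  "ae_eq M = {(f, g). AE s in M. f s = g s}"

definition ae_class :: "'a measure \<Rightarrow> ('a \<Rightarrow> 'b) \<Rightarrow> ('a \<Rightarrow> 'b) set" where
  "ae_class M f = ae_eq M `` {f}"

definition rep :: "('a \<Rightarrow> 'b) set \<Rightarrow> 'a \<Rightarrow> 'b" where
  "rep F = (SOME f. f \<in> F)"

definition Lp :: "'a measure \<Rightarrow> real \<Rightarrow> ('a \<Rightarrow> 'b::real_normed_vector) set set" where
  "Lp M p = {f. strongly_measurable M f \<and> integrable M (\<lambda>s. norm (f s) powr p)} // ae_eq M"

definition Lp_norm :: "'a measure \<Rightarrow> real \<Rightarrow> ('a \<Rightarrow> 'b::real_normed_vector) set \<Rightarrow> real" where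
  "Lp_norm M p F = (\<integral>s. norm (rep F s) powr p \<partial>M) powr (1 / p)"

definition Lp_zero :: "'a measure \<Rightarrow> ('a \<Rightarrow> 'b::real_normed_vector) set" where
  "Lp_zero M = ae_class M (\<lambda>_. 0)"

definition Lp_scale :: "'a measure \<Rightarrow> real \<Rightarrow> ('a \<Rightarrow> 'b::real_normed_vector) set \<Rightarrow> ('a \<Rightarrow> 'b) set" where
  "Lp_scale M t F = ae_class M (\<lambda>s. t *\<^sub>R rep F s)"

definition Lp_diff ::
  "'a measure \<Rightarrow> ('a \<Rightarrow> 'b::real_normed_vector) set \<Rightarrow> ('a \<Rightarrow> 'b) set \<Rightarrow> ('a \<Rightarrow> 'b) set" where
  "Lp_diff M F G = ae_class M (\<lambda>s. rep F s - rep G s)"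

definition Lp_pairing ::
  "'a measure \<Rightarrow> ('a \<Rightarrow> ('b::real_normed_vector \<Rightarrow>\<^sub>L real)) set \<Rightarrow> ('a \<Rightarrow> 'b) set \<Rightarrow> real" where
  "Lp_pairing M \<Phi> F = (\<integral>s. blinfun_apply (rep \<Phi> s) (rep F s) \<partial>M)"

definition Lp_cball :: "'a measure \<Rightarrow> real \<Rightarrow> real \<Rightarrow> ('a \<Rightarrow> 'b::real_normed_vector) set set" where
  "Lp_cball M p r = {F \<in> Lp M p. Lp_norm M p F \<le> r}"

definition Lp_ball :: "'a measure \<Rightarrow> real \<Rightarrow> real \<Rightarrow> ('a \<Rightarrow> 'b::real_normed_vector) set set" where
  "Lp_ball M p r = {F \<in> Lp M p. Lp_norm M p F < r}"

definition Lp_sphere :: "'a measure \<Rightarrow> real \<Rightarrow> real \<Rightarrow> ('a \<Rightarrow> 'b::real_normed_vector) set set" where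
  "Lp_sphere M p r = {F \<in> Lp M p. Lp_norm M p F = r}"


section \<open>Duality mapping, inverse optimality sets, optimal points\<close>

text \<open>Throughout, \<open>q\<close> is the exponent conjugate to \<open>p\<close>.\<close>

definition duality_map ::
  "'a measure \<Rightarrow> real \<Rightarrow> real \<Rightarrow> ('a \<Rightarrow> 'b::real_normed_vector) set \<Rightarrow> ('a \<Rightarrow> ('b \<Rightarrow>\<^sub>L real)) set" where
  "duality_map M p q F =
     (THE \<Phi>. \<Phi> \<in> Lp M q \<and>
        Lp_pairing M \<Phi> F = Lp_norm M q \<Phi> * Lp_norm M p F \<and>
        Lp_norm M q \<Phi> * Lp_norm M p F = (Lp_norm M p F)\<^sup>2 \<and>
        (Lp_norm M p F)\<^sup>2 = (Lp_norm M q \<Phi>)\<^sup>2)"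

text \<open>Suprema are taken in the extended reals, since they may be infinite for unbounded sets.\<close>

definition inv_opt ::
  "'a measure \<Rightarrow> real \<Rightarrow> ('a \<Rightarrow> 'b::real_normed_vector) set set \<Rightarrow> ('a \<Rightarrow> 'b) set
     \<Rightarrow> ('a \<Rightarrow> ('b \<Rightarrow>\<^sub>L real)) set set" where
  "inv_opt M q C G =
     {\<Phi> \<in> Lp M q. ereal (Lp_pairing M \<Phi> G) = (SUP F\<in>C. ereal (Lp_pairing M \<Phi> F))}"

definition inv_opt_star ::
  "'a measure \<Rightarrow> real \<Rightarrow> real \<Rightarrow> ('a \<Rightarrow> 'b::real_normed_vector) set set \<Rightarrow> ('a \<Rightarrow> 'b) set
     \<Rightarrow> ('a \<Rightarrow> 'b) set set" where
  "inv_opt_star M p q C G =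
     {H \<in> Lp M p. ereal (Lp_pairing M (duality_map M p q H) G) =
        (SUP F\<in>C. ereal (Lp_pairing M (duality_map M p q H) F))}"

definition optimal_points ::
  "'a measure \<Rightarrow> real \<Rightarrow> ('a \<Rightarrow> 'b::real_normed_vector) set set \<Rightarrow> ('a \<Rightarrow> 'b) set set" where
  "optimal_points M q C = {G \<in> C. {Lp_zero M} \<subset> inv_opt M q C G}"

definition none_optimal_points ::
  "'a measure \<Rightarrow> real \<Rightarrow> ('a \<Rightarrow> 'b::real_normed_vector) set set \<Rightarrow> ('a \<Rightarrow> 'b) set set" where
  "none_optimal_points M q C = {G \<in> C. \<not> {Lp_zero M} \<subset> inv_opt M q C G}"


section \<open>Curves\<close>

text \<open>Continuity on the half-line is with respect to the metric induced by the norm.\<close>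

definition curve_from_zero_through ::
  "'a measure \<Rightarrow> real \<Rightarrow> ('a \<Rightarrow> 'b::real_normed_vector) set \<Rightarrow> ('a \<Rightarrow> 'b) set set \<Rightarrow> bool" where
  "curve_from_zero_through M p G \<Gamma> \<longleftrightarrow>
     (\<exists>\<gamma> :: real \<Rightarrow> ('a \<Rightarrow> 'b) set.
        \<gamma> \<in> {0..} \<rightarrow> Lp M p \<and>
        (\<forall>t\<ge>0. ((\<lambda>u. Lp_norm M p (Lp_diff M (\<gamma> u) (\<gamma> t))) \<longlongrightarrow> 0) (at t within {0..})) \<and>
        \<gamma> 0 = Lp_zero M \<and>
        G \<in> \<gamma> ` {0..} \<and>
        \<Gamma> = \<gamma> ` {0..})"

end

theory Submission
  imports Defs
begin

text \<open>The duality between the two Bochner spaces is that of a space in which every functional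
  attains its norm and every nonzero point has, up to positive factors, exactly one support
  functional. Since norms are attained, the supremum of a functional \<open>\<Phi>\<close> over the ball of radius
  \<open>r\<close> is \<open>r\<parallel>\<Phi>\<parallel>\<close> (\<open>SUP_pairing_cball\<close>), so that \<open>\<Phi>\<close> lies in the inverse optimality set of \<open>G\<close>
  exactly when \<open>\<langle>\<Phi>, G\<rangle> = r\<parallel>\<Phi>\<parallel>\<close>. By the Hoelder inequality this forces \<open>\<Phi> = 0\<close> if \<open>\<parallel>G\<parallel> < r\<close>. If
  \<open>\<parallel>G\<parallel> = r\<close> it says that \<open>\<Phi>\<close> and \<open>G\<close> give equality in the Hoelder inequality, which, as support
  functionals are unique (\<open>support_functional_unique\<close>), happens exactly for the nonnegative
  multiples of \<open>J G\<close>. Finally \<open>J\<close> is homogeneous, and it is injective because a nonzero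
  functional supports the ball at one point only (\<open>support_point_unique\<close>); hence the set of all \<open>H\<close> with
  \<open>J H = t (J G)\<close> for some \<open>t \<ge> 0\<close> is the ray through \<open>G\<close>, which is a curve.

  The properties of the Bochner spaces come from the value space point by point. Uniform
  smoothness provides each unit vector with a unique support functional that depends
  continuously on the vector; uniform convexity provides each unit functional with a unique
  point of the sphere where it attains its norm, and this point depends continuously on the
  functional. Extended with the gauges \<open>t\<^sup>p\<^sup>-\<^sup>1\<close> and \<open>t\<^sup>q\<^sup>-\<^sup>1\<close>, these continuous maps send
  strongly measurable functions to strongly measurable functions, and the \<open>p\<close>-integrable
  functions to the \<open>q\<close>-integrable ones and vice versa; the images attain equality in the Hoelder
  inequality. Conversely, equality in the Hoelder inequality means equality in the Young
  inequality almost everywhere, so that pointwise uniqueness gives uniqueness of classes.\<close>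

section \<open>Support functionals in uniformly smooth spaces\<close>

text \<open>The support functional is the derivative of the norm. The difference quotients in a direction
  increase with the step, so that the one-sided directional derivative exists as their infimum
  and is a sublinear function of the direction. Smoothness makes it odd, hence linear.\<close>

lemma smooth_support_exists:
  fixes x :: "'b::real_normed_vector"
  assumes smooth: "uniformly_smooth TYPE('b)" and x: "norm x = 1"
  shows "\<exists>\<phi> :: 'b \<Rightarrow>\<^sub>L real. norm \<phi> = 1 \<and> blinfun_apply \<phi> x = 1"
proof -
  define Q where "Q t y = (norm (x + t *\<^sub>R y) - 1) / t" for t :: real and y :: 'b
  define D where "D y = (INF t\<in>{0<..}. Q t y)" for y
  have Q_mono: "Q t y \<le> Q s y" if "0 < t" "t \<le> s" for s t y
  proof -
    have "x + t *\<^sub>R y = (1 - t / s) *\<^sub>R x + (t / s) *\<^sub>R (x + s *\<^sub>R y)"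
      using that by (simp add: algebra_simps)
    then have "norm (x + t *\<^sub>R y) \<le> norm ((1 - t / s) *\<^sub>R x) + norm ((t / s) *\<^sub>R (x + s *\<^sub>R y))"
      by (metis norm_triangle_ineq)
    also have "\<dots> = (1 - t / s) + (t / s) * norm (x + s *\<^sub>R y)"
      using that x by simp
    finally have "norm (x + t *\<^sub>R y) - 1 \<le> (t / s) * (norm (x + s *\<^sub>R y) - 1)"
      by (simp add: algebra_simps)
    then have "Q t y \<le> (t / s) * (norm (x + s *\<^sub>R y) - 1) / t"
      unfolding Q_def using that by (intro divide_right_mono) auto
    also have "\<dots> = Q s y"
      unfolding Q_def using that by simp
    finally show ?thesis .
  qed
  have Q_bound: "\<bar>Q t y\<bar> \<le> norm y" if "0 < t" for t y
  proof -
    have "\<bar>norm (x + t *\<^sub>R y) - norm x\<bar> \<le> norm (t *\<^sub>R y)"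
      using norm_triangle_ineq3[of "x + t *\<^sub>R y" x] by simp
    then show ?thesis
      using that x by (simp add: Q_def abs_divide divide_le_eq mult.commute)
  qed
  have D_le: "D y \<le> Q t y" if "0 < t" for t y
    unfolding D_def
  proof (rule cINF_lower)
    show "bdd_below ((\<lambda>t. Q t y) ` {0<..})"
      using Q_bound[of _ y] by (intro bdd_belowI2[where m = "- norm y"]) (force simp: abs_le_iff)
  qed (use that in auto)
  have D_ge: "c \<le> D y" if "\<And>t. 0 < t \<Longrightarrow> c \<le> Q t y" for c y
    unfolding D_def by (rule cINF_greatest) (use that in auto)
  have D_near: "\<exists>T>0. \<forall>t. 0 < t \<longrightarrow> t \<le> T \<longrightarrow> Q t y < D y + e" if "0 < e" for e y
  proof -
    have "\<not> D y + e \<le> D y" using that by simp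
    then obtain T where "0 < T" "Q T y < D y + e"
      using D_ge[of "D y + e" y] by force
    then show ?thesis using Q_mono by (meson le_less_trans)
  qed
  \<comment> \<open>Step \<open>s / 2\<close> in direction \<open>y + z\<close> is the midpoint of the steps \<open>s\<close> in directions \<open>y\<close> and \<open>z\<close>.\<close>
  have D_add_le: "D (y + z) \<le> D y + D z" for y z
  proof (rule field_le_epsilon)
    fix e :: real assume "0 < e"
    then obtain T1 T2 where T: "0 < T1" "\<And>t. 0 < t \<Longrightarrow> t \<le> T1 \<Longrightarrow> Q t y < D y + e / 2"
      "0 < T2" "\<And>t. 0 < t \<Longrightarrow> t \<le> T2 \<Longrightarrow> Q t z < D z + e / 2"
      using D_near[of "e / 2"] by (metis half_gt_zero)
    define s where "s = min T1 T2"
    have s: "0 < s" "s \<le> T1" "s \<le> T2" using T by (auto simp: s_def)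
    have "x + (s / 2) *\<^sub>R (y + z) = (1 / 2) *\<^sub>R (x + s *\<^sub>R y) + (1 / 2) *\<^sub>R (x + s *\<^sub>R z)"
      by (simp add: algebra_simps flip: scaleR_add_left)
    then have "norm (x + (s / 2) *\<^sub>R (y + z)) \<le> norm (x + s *\<^sub>R y) / 2 + norm (x + s *\<^sub>R z) / 2"
      using norm_triangle_ineq[of "(1 / 2) *\<^sub>R (x + s *\<^sub>R y)" "(1 / 2) *\<^sub>R (x + s *\<^sub>R z)"] by simp
    then have "Q (s / 2) (y + z) \<le> (norm (x + s *\<^sub>R y) / 2 + norm (x + s *\<^sub>R z) / 2 - 1) / (s / 2)"
      unfolding Q_def using s by (intro divide_right_mono) auto
    also have "\<dots> = Q s y + Q s z"
      using s by (simp add: Q_def field_simps)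
    finally have "Q (s / 2) (y + z) \<le> Q s y + Q s z" .
    moreover have "D (y + z) \<le> Q (s / 2) (y + z)" using s by (intro D_le) simp
    ultimately show "D (y + z) \<le> D y + D z + e" using T(2,4)[OF s(1)] s by force
  qed
  have D_scale_ge: "c * D y \<le> D (c *\<^sub>R y)" if "0 < c" for c y
  proof (rule D_ge)
    fix t :: real assume "0 < t"
    then have "Q t (c *\<^sub>R y) = c * Q (t * c) y" using that by (simp add: Q_def)
    then show "c * D y \<le> Q t (c *\<^sub>R y)" using D_le[of "t * c" y] \<open>0 < t\<close> that by simp
  qed
  have D_scale_pos: "D (c *\<^sub>R y) = c * D y" if "0 < c" for c y
    using D_scale_ge[of c y] D_scale_ge[of "1 / c" "c *\<^sub>R y"] that by (simp add: field_simps)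
  have D0: "D 0 = 0"
    using D_le[of 1 0] D_ge[of 0 0] x by (simp add: Q_def)
  have D_minus: "D (- y) = - D y" for y
  proof (rule antisym)
    have "D y + D (- y) \<le> 0"
    proof (rule field_le_epsilon)
      fix e :: real assume "0 < e"
      \<comment> \<open>Adding 1 to the norm keeps the quotients defined when \<open>y = 0\<close>.\<close>
      define k where "k = e / (norm y + 1)"
      have "0 < norm y + 1" by (simp add: add_nonneg_pos)
      then have k: "0 < k" "k * norm y \<le> e"
        using \<open>0 < e\<close> by (auto simp: k_def field_simps)
      obtain d where d: "0 < d" "\<And>x y :: 'b. norm x = 1 \<Longrightarrow> norm y \<le> d \<Longrightarrow>
          norm (x + y) + norm (x - y) \<le> 2 + k * norm y"
        using smooth k(1) unfolding uniformly_smooth_def by blast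
      define t where "t = d / (norm y + 1)"
      have t: "0 < t" "norm (t *\<^sub>R y) \<le> d"
        using \<open>0 < norm y + 1\<close> d(1) by (auto simp: t_def field_simps)
      have "Q t y + Q t (- y) = (norm (x + t *\<^sub>R y) + norm (x - t *\<^sub>R y) - 2) / t"
        by (simp add: Q_def add_divide_distrib diff_divide_distrib)
      also have "\<dots> \<le> (k * norm (t *\<^sub>R y)) / t"
        using d(2)[OF x t(2)] t(1) by (intro divide_right_mono) auto
      also have "\<dots> = k * norm y" using t(1) by simp
      finally show "D y + D (- y) \<le> 0 + e"
        using D_le[OF t(1), of y] D_le[OF t(1), of "- y"] k(2) by linarith
    qed
    then show "D (- y) \<le> - D y" by simp
    show "- D y \<le> D (- y)" using D_add_le[of y "- y"] D0 by simp
  qed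
  have D_add: "D (y + z) = D y + D z" for y z
    using D_add_le[of y z] D_add_le[of "- y" "- z"] D_minus[of "y + z"] D_minus[of y] D_minus[of z]
    by simp
  have D_scale: "D (c *\<^sub>R y) = c * D y" for c y
  proof -
    consider "0 < c" | "c = 0" | "0 < - c" by linarith
    then show ?thesis
    proof cases
      case 3
      show ?thesis using D_scale_pos[OF 3, of y] D_minus[of "c *\<^sub>R y"] by simp
    qed (auto simp: D_scale_pos D0)
  qed
  have D_bound: "\<bar>D y\<bar> \<le> norm y" for y
  proof -
    have "D z \<le> norm z" for z using D_le[of 1 z] Q_bound[of 1 z] by simp
    from this[of y] this[of "- y"] show ?thesis by (simp add: D_minus abs_le_iff)
  qed
  have "Q t x = 1" if "0 < t" for t
  proof -
    have "x + t *\<^sub>R x = (1 + t) *\<^sub>R x" by (simp add: algebra_simps)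
    then show ?thesis using that x by (simp add: Q_def)
  qed
  then have Dx: "D x = 1" using D_le[of 1 x] D_ge[of 1 x] by simp
  have bl: "bounded_linear D"
    by (rule bounded_linear_intro[where K = 1]) (use D_add D_scale D_bound in auto)
  have app: "blinfun_apply (Blinfun D) = D" by (rule bounded_linear_Blinfun_apply[OF bl])
  have "norm (Blinfun D) = 1"
    by (rule norm_blinfun_eqI[where x = x]) (use app Dx x D_bound in auto)
  then show ?thesis using app Dx by auto
qed

text \<open>The two functionals are compared through \<open>\<phi> (x + z) + \<psi> (x - z) \<le> \<parallel>x + z\<parallel> + \<parallel>x - z\<parallel>\<close>:
  smoothness at \<open>x\<close> bounds the right-hand side by \<open>2\<close> plus a small multiple of \<open>\<parallel>z\<parallel>\<close>, and
  \<open>1 - \<psi> x\<close> is at most \<open>\<parallel>x - y\<parallel>\<close>. The case \<open>x = y\<close> gives uniqueness of the support functional,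
  small \<open>\<parallel>x - y\<parallel>\<close> its continuous dependence on the point.\<close>

lemma smooth_support_close:
  assumes smooth: "uniformly_smooth TYPE('b::real_normed_vector)" and "0 < e"
  shows "\<exists>d>0. \<forall>(x::'b) y (\<phi> :: 'b \<Rightarrow>\<^sub>L real) \<psi>. norm x = 1 \<longrightarrow> norm y = 1 \<longrightarrow> norm \<phi> \<le> 1 \<longrightarrow> norm \<psi> \<le> 1 \<longrightarrow>
    blinfun_apply \<phi> x = 1 \<longrightarrow> blinfun_apply \<psi> y = 1 \<longrightarrow> norm (x - y) \<le> d \<longrightarrow> norm (\<phi> - \<psi>) \<le> e"
proof -
  obtain d where d: "0 < d" "\<And>x y :: 'b. norm x = 1 \<Longrightarrow> norm y \<le> d \<Longrightarrow>
      norm (x + y) + norm (x - y) \<le> 2 + e / 2 * norm y"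
    using smooth \<open>0 < e\<close> unfolding uniformly_smooth_def by (meson half_gt_zero)
  have le: "blinfun_apply \<eta> v \<le> norm v" if "norm \<eta> \<le> 1" for \<eta> :: "'b \<Rightarrow>\<^sub>L real" and v
    using norm_blinfun[of \<eta> v] that mult_right_mono[of "norm \<eta>" 1 "norm v"] by force
  have "norm (\<phi> - \<psi>) \<le> e"
    if "norm x = 1" "norm y = 1" "norm \<phi> \<le> 1" "norm \<psi> \<le> 1"
      "blinfun_apply \<phi> x = 1" "blinfun_apply \<psi> y = 1" "norm (x - y) \<le> d * e / 2"
    for x y :: 'b and \<phi> \<psi> :: "'b \<Rightarrow>\<^sub>L real"
  proof -
    \<comment> \<open>Half of this bound comes from \<open>\<parallel>x - y\<parallel> \<le> d * e / 2\<close>, the other half from smoothness with \<open>e / 2\<close>.\<close>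
    have key: "blinfun_apply (\<phi> - \<psi>) z \<le> d * e" if z: "norm z = d" for z
    proof -
      have "blinfun_apply \<phi> (x + z) + blinfun_apply \<psi> (x - z) \<le> norm (x + z) + norm (x - z)"
        using le \<open>norm \<phi> \<le> 1\<close> \<open>norm \<psi> \<le> 1\<close> by (intro add_mono) auto
      also have "\<dots> \<le> 2 + e / 2 * d" using d(2)[of x z] \<open>norm x = 1\<close> z by simp
      finally have "blinfun_apply (\<phi> - \<psi>) z \<le> 1 - blinfun_apply \<psi> x + e / 2 * d"
        using \<open>blinfun_apply \<phi> x = 1\<close>
        by (simp add: blinfun.add_right blinfun.diff_right blinfun.diff_left)
      moreover have "1 - blinfun_apply \<psi> x \<le> d * e / 2"
        using le[OF \<open>norm \<psi> \<le> 1\<close>, of "y - x"] \<open>blinfun_apply \<psi> y = 1\<close> \<open>norm (x - y) \<le> d * e / 2\<close>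
        by (simp add: blinfun.diff_right norm_minus_commute)
      ultimately show ?thesis by (simp add: field_simps)
    qed
    show ?thesis
    proof (rule norm_blinfun_bound)
      fix v
      show "norm (blinfun_apply (\<phi> - \<psi>) v) \<le> e * norm v"
      proof (cases "v = 0")
        case False
        define c where "c = d / norm v"
        have c: "0 < c" "norm (c *\<^sub>R v) = d" "norm (- (c *\<^sub>R v)) = d"
          using False d(1) by (auto simp: c_def)
        have "c * \<bar>blinfun_apply (\<phi> - \<psi>) v\<bar> \<le> d * e"
          using key[OF c(2)] key[OF c(3)] c(1) 
          by (cases "0 \<le> blinfun_apply (\<phi> - \<psi>) v") (auto simp: blinfun.scaleR_right blinfun.minus_right)
        then show ?thesis using False d(1) by (simp add: c_def field_simps)
      qed simp
    qed (use \<open>0 < e\<close> in simp)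
  qed
  then show ?thesis using d(1) \<open>0 < e\<close> by (intro exI[where x = "d * e / 2"]) auto
qed

text \<open>The last premise settles the vector \<open>0\<close>, at which every functional satisfies the equations.\<close>

lemma smooth_support_unique:
  fixes x :: "'b::real_normed_vector" and \<phi> \<psi> :: "'b \<Rightarrow>\<^sub>L real"
  assumes smooth: "uniformly_smooth TYPE('b)"
    and eq: "norm \<phi> = norm \<psi>" "blinfun_apply \<phi> x = norm \<phi> * norm x" "blinfun_apply \<psi> x = norm \<psi> * norm x"
    and "x = 0 \<Longrightarrow> \<phi> = 0"
  shows "\<phi> = \<psi>"
proof (cases "\<phi> = 0 \<or> x = 0")
  case True
  then show ?thesis using assms by auto
next
  case False
  then have pos: "0 < norm \<phi>" "0 < norm \<psi>" "0 < norm x" using eq(1) by auto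
  have "norm (\<phi> /\<^sub>R norm \<phi> - \<psi> /\<^sub>R norm \<phi>) \<le> 0"
  proof (rule field_le_epsilon)
    fix e :: real assume "0 < e"
    from smooth_support_close[OF smooth this]
    obtain d where d: "0 < d" "\<And>(x::'b) y (\<phi> :: 'b \<Rightarrow>\<^sub>L real) \<psi>. norm x = 1 \<Longrightarrow> norm y = 1 \<Longrightarrow> norm \<phi> \<le> 1 \<Longrightarrow>
       norm \<psi> \<le> 1 \<Longrightarrow> blinfun_apply \<phi> x = 1 \<Longrightarrow> blinfun_apply \<psi> y = 1 \<Longrightarrow> norm (x - y) \<le> d \<Longrightarrow> norm (\<phi> - \<psi>) \<le> e"
      by metis
    show "norm (\<phi> /\<^sub>R norm \<phi> - \<psi> /\<^sub>R norm \<phi>) \<le> 0 + e"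
      using d(2)[of "x /\<^sub>R norm x" "x /\<^sub>R norm x" "\<phi> /\<^sub>R norm \<phi>" "\<psi> /\<^sub>R norm \<phi>"] pos eq d(1)
      by (simp add: blinfun.scaleR_left blinfun.scaleR_right field_simps)
  qed
  then show ?thesis using pos by simp
qed

section \<open>Norm attainment in uniformly convex spaces\<close>

text \<open>On the midpoint of two near-maximizers \<open>\<phi>\<close> exceeds \<open>1 - d\<close>, so that the norm of the midpoint
  does as well; uniform convexity then bounds their distance. Existence, uniqueness and
  continuous dependence of maximizers all follow from this.\<close>

lemma convex_near_maximizers_close:
  assumes convex: "uniformly_convex TYPE('b::real_normed_vector)" and "0 < e"
  shows "\<exists>d>0. \<forall>(\<phi> :: 'b \<Rightarrow>\<^sub>L real) x y. norm \<phi> \<le> 1 \<longrightarrow> norm x = 1 \<longrightarrow> norm y = 1 \<longrightarrow>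
    1 - d < blinfun_apply \<phi> x \<longrightarrow> 1 - d < blinfun_apply \<phi> y \<longrightarrow> norm (x - y) < e"
proof -
  obtain d where d: "0 < d" "\<And>x y :: 'b. norm x = 1 \<Longrightarrow> norm y = 1 \<Longrightarrow> norm (x - y) \<ge> e \<Longrightarrow>
      norm ((1/2) *\<^sub>R (x + y)) \<le> 1 - d"
    using convex \<open>0 < e\<close> unfolding uniformly_convex_def by blast
  have "norm (x - y) < e"
    if "norm \<phi> \<le> 1" "norm x = 1" "norm y = 1" "1 - d < blinfun_apply \<phi> x" "1 - d < blinfun_apply \<phi> y"
    for \<phi> :: "'b \<Rightarrow>\<^sub>L real" and x y
  proof (rule ccontr)
    assume "\<not> norm (x - y) < e"
    then have "norm ((1/2) *\<^sub>R (x + y)) \<le> 1 - d" using d(2) that by simp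
    moreover have "blinfun_apply \<phi> ((1/2) *\<^sub>R (x + y)) \<le> norm ((1/2) *\<^sub>R (x + y))"
      using norm_blinfun[of \<phi> "(1/2) *\<^sub>R (x + y)"] that(1)
        mult_right_mono[of "norm \<phi>" 1 "norm ((1/2) *\<^sub>R (x + y))"] by (simp del: norm_scaleR)
    ultimately show False
      using that(4,5) by (simp add: blinfun.scaleR_right blinfun.add_right)
  qed
  then show ?thesis using d(1) by blast
qed

text \<open>A maximizing sequence on the sphere is Cauchy, as near-maximizers are close to each other; its
  limit is the maximizer.\<close>

lemma convex_maximizer_exists:
  fixes \<phi> :: "'b::banach \<Rightarrow>\<^sub>L real"
  assumes convex: "uniformly_convex TYPE('b)" and \<phi>: "norm \<phi> = 1"
  shows "\<exists>x. norm x = 1 \<and> blinfun_apply \<phi> x = 1"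
proof -
  have le: "blinfun_apply \<phi> v \<le> norm v" for v
    using norm_blinfun[of \<phi> v] \<phi> by simp
  have "\<exists>x. norm x = 1 \<and> 1 - h < blinfun_apply \<phi> x" if "0 < h" for h
  proof (rule ccontr)
    assume no: "\<not> ?thesis"
    have "norm \<phi> \<le> max 0 (1 - h)"
    proof (rule norm_blinfun_bound)
      fix v :: 'b
      show "norm (blinfun_apply \<phi> v) \<le> max 0 (1 - h) * norm v"
      proof (cases "v = 0")
        case False
        have "norm (v /\<^sub>R norm v) = 1" "norm (- (v /\<^sub>R norm v)) = 1" using False by auto
        then have "blinfun_apply \<phi> (v /\<^sub>R norm v) \<le> 1 - h" "blinfun_apply \<phi> (- (v /\<^sub>R norm v)) \<le> 1 - h"
          using no by (meson not_le)+
        then have "\<bar>blinfun_apply \<phi> v\<bar> / norm v \<le> 1 - h"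
          by (cases "0 \<le> blinfun_apply \<phi> v")
            (auto simp: blinfun.scaleR_right blinfun.minus_right field_simps)
        then have "\<bar>blinfun_apply \<phi> v\<bar> \<le> (1 - h) * norm v" using False by (simp add: field_simps)
        also have "\<dots> \<le> max 0 (1 - h) * norm v" by (intro mult_right_mono) auto
        finally show ?thesis by simp
      qed simp
    qed simp
    then show False using \<phi> that by simp
  qed
  then have "\<exists>x. norm x = 1 \<and> 1 - 1 / Suc n < blinfun_apply \<phi> x" for n
    by simp
  then obtain X where X: "\<And>n. norm (X n) = 1" "\<And>n. 1 - 1 / Suc n < blinfun_apply \<phi> (X n)"
    by metis
  have "Cauchy X"
  proof (rule metric_CauchyI)
    fix e :: real assume "0 < e"
    from convex_near_maximizers_close[OF convex this]
    obtain d where d: "0 < d" "\<And>(\<phi> :: 'b \<Rightarrow>\<^sub>L real) x y. norm \<phi> \<le> 1 \<Longrightarrow> norm x = 1 \<Longrightarrow> norm y = 1 \<Longrightarrow>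
      1 - d < blinfun_apply \<phi> x \<Longrightarrow> 1 - d < blinfun_apply \<phi> y \<Longrightarrow> norm (x - y) < e"
      by metis
    obtain N where N: "inverse (real (Suc N)) < d" using reals_Archimedean[OF d(1)] by blast
    have "1 - d < blinfun_apply \<phi> (X n)" if "N \<le> n" for n
    proof -
      have "1 / real (Suc n) \<le> inverse (real (Suc N))" using that by (simp add: field_simps)
      then show ?thesis using X(2)[of n] N by linarith
    qed
    then show "\<exists>M. \<forall>m\<ge>M. \<forall>n\<ge>M. dist (X m) (X n) < e"
      using d(2)[of \<phi>] X(1) \<phi> unfolding dist_norm by (intro exI[where x = N]) auto
  qed
  then obtain x where x: "X \<longlonglongrightarrow> x" using Cauchy_convergent convergent_def by blast
  have "(\<lambda>n. norm (X n)) \<longlonglongrightarrow> norm x" using x by (rule tendsto_norm)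
  then have "norm x = 1" using X(1) by (simp add: LIMSEQ_const_iff)
  moreover have "1 \<le> blinfun_apply \<phi> x"
  proof (rule LIMSEQ_le)
    show "(\<lambda>n. 1 - 1 / real (Suc n)) \<longlonglongrightarrow> 1"
      using LIMSEQ_inverse_real_of_nat_add_minus[of 1] by (simp add: field_simps)
    show "(\<lambda>n. blinfun_apply \<phi> (X n)) \<longlonglongrightarrow> blinfun_apply \<phi> x"
      using x by (intro tendsto_intros)
    show "\<exists>N. \<forall>n\<ge>N. 1 - 1 / real (Suc n) \<le> blinfun_apply \<phi> (X n)"
      using X(2) less_imp_le by blast
  qed
  ultimately show ?thesis using le[of x] by (intro exI[where x = x]) auto
qed

lemma convex_maximizer_unique:
  fixes x y :: "'b::real_normed_vector" and \<phi> :: "'b \<Rightarrow>\<^sub>L real"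
  assumes convex: "uniformly_convex TYPE('b)"
    and eq: "norm x = norm y" "blinfun_apply \<phi> x = norm \<phi> * norm x" "blinfun_apply \<phi> y = norm \<phi> * norm y"
    and "\<phi> = 0 \<Longrightarrow> x = 0"
  shows "x = y"
proof (cases "\<phi> = 0 \<or> x = 0")
  case True
  then show ?thesis using assms by auto
next
  case False
  then have pos: "0 < norm \<phi>" "0 < norm x" "0 < norm y" using eq(1) by auto
  have "norm (x /\<^sub>R norm x - y /\<^sub>R norm x) \<le> 0"
  proof (rule field_le_epsilon)
    fix e :: real assume "0 < e"
    from convex_near_maximizers_close[OF convex this]
    obtain d where d: "0 < d" "\<And>(\<phi> :: 'b \<Rightarrow>\<^sub>L real) x y. norm \<phi> \<le> 1 \<Longrightarrow> norm x = 1 \<Longrightarrow> norm y = 1 \<Longrightarrow>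
      1 - d < blinfun_apply \<phi> x \<Longrightarrow> 1 - d < blinfun_apply \<phi> y \<Longrightarrow> norm (x - y) < e"
      by metis
    show "norm (x /\<^sub>R norm x - y /\<^sub>R norm x) \<le> 0 + e"
      using d(2)[of "\<phi> /\<^sub>R norm \<phi>" "x /\<^sub>R norm x" "y /\<^sub>R norm x"] pos eq d(1)
      by (simp add: blinfun.scaleR_left blinfun.scaleR_right field_simps)
  qed
  then show ?thesis using pos by simp
qed

section \<open>Duality mappings with a power gauge\<close>

text \<open>The gauge factor gives the extension of a map between unit spheres the growth that carries
  \<open>p\<close>-integrable functions to \<open>q\<close>-integrable ones. At \<open>0\<close> the value is \<open>0\<close>, because
  \<open>0 powr a = 0\<close>; for \<open>p > 1\<close> this is the continuous choice.\<close>

definition radial_extension ::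
  "real \<Rightarrow> ('c::real_normed_vector \<Rightarrow> 'd::real_normed_vector) \<Rightarrow> 'c \<Rightarrow> 'd" where
  "radial_extension p j x = norm x powr (p - 1) *\<^sub>R j (x /\<^sub>R norm x)"

lemma radial_extension_0 [simp]: "radial_extension p j 0 = 0"
  by (simp add: radial_extension_def)

lemma norm_radial_extension:
  assumes "\<And>u. norm u = 1 \<Longrightarrow> norm (j u) = 1"
  shows "norm (radial_extension p j x) = norm x powr (p - 1)"
  using assms[of "x /\<^sub>R norm x"] by (cases "x = 0") (auto simp: radial_extension_def)

lemma continuous_on_radial_extension:
  fixes j :: "'c::real_normed_vector \<Rightarrow> 'd::real_normed_vector"
  assumes j: "continuous_on (sphere 0 1) j" "\<And>u. norm u = 1 \<Longrightarrow> norm (j u) = 1" and "1 < p"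
  shows "continuous_on UNIV (radial_extension p j)"
proof -
  have away: "continuous_on (- {0}) (radial_extension p j)"
    unfolding radial_extension_def
    by (intro continuous_intros continuous_on_compose2[OF j(1)] image_subsetI) auto
  have "isCont (radial_extension p j) x" for x
  proof (cases "x = 0")
    case False
    then show ?thesis using away by (simp add: continuous_on_eq_continuous_at open_Compl)
  next
    case True
    have "((\<lambda>y. norm y powr (p - 1)) \<longlongrightarrow> norm (0::'c) powr (p - 1)) (at (0::'c))"
      using \<open>1 < p\<close> by (intro tendsto_powr' tendsto_intros) auto
    then have "((\<lambda>y. norm (radial_extension p j y)) \<longlongrightarrow> 0) (at (0::'c))"
      using \<open>1 < p\<close> by (simp add: norm_radial_extension[OF j(2)])
    then have "(radial_extension p j \<longlongrightarrow> 0) (at 0)" by (rule tendsto_norm_zero_cancel)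
    then show ?thesis using True by (simp add: isCont_def)
  qed
  then show ?thesis by (simp add: continuous_at_imp_continuous_on)
qed

text \<open>This is the duality mapping of the value space with gauge \<open>t\<^sup>p\<^sup>-\<^sup>1\<close>. Applied pointwise, it
  yields support functionals in the Bochner space.\<close>

lemma smooth_gauge_map:
  assumes smooth: "uniformly_smooth TYPE('b)" and "1 < p"
  obtains K :: "'b::real_normed_vector \<Rightarrow> ('b \<Rightarrow>\<^sub>L real)"
  where "continuous_on UNIV K" "\<And>x. norm (K x) = norm x powr (p - 1)"
    "\<And>x. blinfun_apply (K x) x = norm x powr p"
proof -
  obtain j :: "'b \<Rightarrow> ('b \<Rightarrow>\<^sub>L real)"
    where j: "\<And>x. norm x = 1 \<Longrightarrow> norm (j x) = 1" "\<And>x. norm x = 1 \<Longrightarrow> blinfun_apply (j x) x = 1"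
    using smooth_support_exists[OF smooth] by metis
  have cont: "continuous_on (sphere 0 1) j"
    unfolding continuous_on_iff
  proof safe
    fix x :: 'b and e :: real assume x: "x \<in> sphere 0 1" and "0 < e"
    then have "0 < e / 2" by simp
    from smooth_support_close[OF smooth this]
    obtain d where d: "0 < d" "\<And>(x::'b) y (\<phi> :: 'b \<Rightarrow>\<^sub>L real) \<psi>. norm x = 1 \<Longrightarrow> norm y = 1 \<Longrightarrow> norm \<phi> \<le> 1 \<Longrightarrow>
       norm \<psi> \<le> 1 \<Longrightarrow> blinfun_apply \<phi> x = 1 \<Longrightarrow> blinfun_apply \<psi> y = 1 \<Longrightarrow> norm (x - y) \<le> d \<Longrightarrow> norm (\<phi> - \<psi>) \<le> e / 2"
      by metis
    show "\<exists>d>0. \<forall>y\<in>sphere 0 1. dist y x < d \<longrightarrow> dist (j y) (j x) < e"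
    proof (intro exI conjI ballI impI)
      fix y assume y: "y \<in> sphere 0 1" "dist y x < d"
      then have "norm (j y - j x) \<le> e / 2"
        using x j by (intro d(2)[of y x]) (auto simp: dist_norm)
      then show "dist (j y) (j x) < e" using \<open>0 < e\<close> by (simp add: dist_norm)
    qed (use d in auto)
  qed
  show thesis
  proof
    show "continuous_on UNIV (radial_extension p j)"
      using continuous_on_radial_extension[OF cont j(1) \<open>1 < p\<close>] by simp
    show "norm (radial_extension p j x) = norm x powr (p - 1)" for x
      using norm_radial_extension[of j] j(1) by simp
    show "blinfun_apply (radial_extension p j x) x = norm x powr p" for x
    proof (cases "x = 0")
      case False
      have "blinfun_apply (j (x /\<^sub>R norm x)) x = norm x"
        using j(2)[of "x /\<^sub>R norm x"] False by (simp add: blinfun.scaleR_right field_simps)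
      then show ?thesis using False
        by (simp add: radial_extension_def blinfun.scaleR_left powr_diff)
    qed simp
  qed
qed

text \<open>The counterpart on the dual: applied pointwise to a functional in \<open>L\<^sub>q\<close>, it yields a function
  in \<open>L\<^sub>p\<close> at which the functional attains its norm.\<close>

lemma convex_gauge_map:
  assumes convex: "uniformly_convex TYPE('b)" and "1 < q"
  obtains K :: "('b::banach \<Rightarrow>\<^sub>L real) \<Rightarrow> 'b"
  where "continuous_on UNIV K" "\<And>\<phi>. norm (K \<phi>) = norm \<phi> powr (q - 1)"
    "\<And>\<phi>. blinfun_apply \<phi> (K \<phi>) = norm \<phi> powr q"
proof -
  obtain j :: "('b \<Rightarrow>\<^sub>L real) \<Rightarrow> 'b"
    where j: "\<And>\<phi>. norm \<phi> = 1 \<Longrightarrow> norm (j \<phi>) = 1" "\<And>\<phi>. norm \<phi> = 1 \<Longrightarrow> blinfun_apply \<phi> (j \<phi>) = 1"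
    using convex_maximizer_exists[OF convex] by metis
  have cont: "continuous_on (sphere 0 1) j"
    unfolding continuous_on_iff
  proof safe
    fix \<phi> :: "'b \<Rightarrow>\<^sub>L real" and e :: real assume \<phi>: "\<phi> \<in> sphere 0 1" and "0 < e"
    from convex_near_maximizers_close[OF convex \<open>0 < e\<close>]
    obtain d where d: "0 < d" "\<And>(\<phi> :: 'b \<Rightarrow>\<^sub>L real) x y. norm \<phi> \<le> 1 \<Longrightarrow> norm x = 1 \<Longrightarrow> norm y = 1 \<Longrightarrow>
      1 - d < blinfun_apply \<phi> x \<Longrightarrow> 1 - d < blinfun_apply \<phi> y \<Longrightarrow> norm (x - y) < e"
      by metis
    show "\<exists>d>0. \<forall>\<psi>\<in>sphere 0 1. dist \<psi> \<phi> < d \<longrightarrow> dist (j \<psi>) (j \<phi>) < e"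
    proof (intro exI conjI ballI impI)
      fix \<psi> assume \<psi>: "\<psi> \<in> sphere 0 1" "dist \<psi> \<phi> < d"
      have "blinfun_apply (\<psi> - \<phi>) (j \<psi>) \<le> norm (\<psi> - \<phi>)"
        using norm_blinfun[of "\<psi> - \<phi>" "j \<psi>"] j(1)[of \<psi>] \<psi>(1) by simp
      then have "1 - d < blinfun_apply \<phi> (j \<psi>)"
        using j(2)[of \<psi>] \<psi> by (simp add: blinfun.diff_left dist_norm)
      then show "dist (j \<psi>) (j \<phi>) < e"
        using d(2)[of \<phi> "j \<psi>" "j \<phi>"] d(1) \<phi> \<psi>(1) j by (simp add: dist_norm)
    qed (use d in auto)
  qed
  show thesis
  proof
    show "continuous_on UNIV (radial_extension q j)"
      using continuous_on_radial_extension[OF cont j(1) \<open>1 < q\<close>] by simp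
    show "norm (radial_extension q j \<phi>) = norm \<phi> powr (q - 1)" for \<phi>
      using norm_radial_extension[of j] j(1) by simp
    show "blinfun_apply \<phi> (radial_extension q j \<phi>) = norm \<phi> powr q" for \<phi>
    proof (cases "\<phi> = 0")
      case False
      have "blinfun_apply \<phi> (j (\<phi> /\<^sub>R norm \<phi>)) = norm \<phi>"
        using j(2)[of "\<phi> /\<^sub>R norm \<phi>"] False by (simp add: blinfun.scaleR_left field_simps)
      then show ?thesis using False
        by (simp add: radial_extension_def blinfun.scaleR_right powr_diff)
    qed simp
  qed
qed

section \<open>Equality in the Young inequality\<close>

text \<open>The product of \<open>c a\<close> and \<open>b / c\<close> does not depend on \<open>c\<close>, so that in case of equality the Young
  bound for these factors, as a function of \<open>c\<close>, has its minimum at \<open>c = 1\<close>. The derivative of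
  that bound at \<open>1\<close> is the difference of the two powers.\<close>

lemma Youngs_equality:
  fixes a b p q :: real
  assumes pq: "1 < p" "1 < q" "1 / p + 1 / q = 1" and ab: "0 \<le> a" "0 \<le> b"
    and eq: "a * b = a powr p / p + b powr q / q"
  shows "a powr p = b powr q"
proof -
  define h where "h c = c powr p * a powr p / p + c powr (- q) * b powr q / q" for c :: real
  have "(h has_real_derivative (a powr p - b powr q)) (at 1)"
    unfolding h_def using pq by (auto intro!: derivative_eq_intros)
  moreover have "h 1 \<le> h c" if "\<bar>1 - c\<bar> < 1" for c
  proof -
    have c: "0 < c" using that by simp
    have "h 1 = (c * a) * (b / c)" using eq c by (simp add: h_def)
    also have "\<dots> \<le> (c * a) powr p / p + (b / c) powr q / q"
      using pq ab c by (intro Youngs_inequality) auto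
    also have "\<dots> = h c"
      using c ab by (simp add: h_def powr_mult powr_divide powr_minus_divide)
    finally show ?thesis .
  qed
  ultimately have "a powr p - b powr q = 0"
    using DERIV_local_min[of h "a powr p - b powr q" 1 1] by simp
  then show ?thesis by simp
qed

section \<open>Strong measurability\<close>

lemma strongly_measurable_AE_cong:
  assumes "strongly_measurable M f" "AE s in M. f s = g s"
  shows "strongly_measurable M g"
proof -
  obtain u where u: "\<And>i::nat. Bochner_Integration.simple_bochner_integrable M (u i)"
    "AE s in M. (\<lambda>i. u i s) \<longlonglongrightarrow> f s"
    using assms(1) unfolding strongly_measurable_def by blast
  have "AE s in M. (\<lambda>i. u i s) \<longlonglongrightarrow> g s" using u(2) assms(2) by eventually_elim simp
  then show ?thesis unfolding strongly_measurable_def using u(1) by blast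
qed

text \<open>The condition at \<open>0\<close> ensures that composing simple functions keeps the support of finite
  measure.\<close>

lemma strongly_measurable_compose2:
  assumes h: "continuous_on UNIV (\<lambda>(x, y). h x y)" "h 0 0 = 0"
    and fg: "strongly_measurable M f" "strongly_measurable M g"
  shows "strongly_measurable M (\<lambda>s. h (f s) (g s))"
proof -
  obtain u where u: "\<And>i::nat. Bochner_Integration.simple_bochner_integrable M (u i)"
    "AE s in M. (\<lambda>i. u i s) \<longlonglongrightarrow> f s"
    using fg(1) unfolding strongly_measurable_def by blast
  obtain v where v: "\<And>i::nat. Bochner_Integration.simple_bochner_integrable M (v i)"
    "AE s in M. (\<lambda>i. v i s) \<longlonglongrightarrow> g s"
    using fg(2) unfolding strongly_measurable_def by blast
  have "AE s in M. (\<lambda>i. h (u i s) (v i s)) \<longlonglongrightarrow> h (f s) (g s)"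
    using u(2) v(2)
  proof eventually_elim
    case (elim s)
    then show ?case
      using continuous_on_tendsto_compose[OF h(1) tendsto_Pair, of "\<lambda>i. u i s" "f s" sequentially "\<lambda>i. v i s" "g s"]
      by simp
  qed
  moreover have "Bochner_Integration.simple_bochner_integrable M (\<lambda>s. h (u i s) (v i s))" for i
    using Bochner_Integration.simple_bochner_integrable_compose2[of h M "u i" "v i"] h(2) u(1) v(1) by blast
  ultimately show ?thesis
    unfolding strongly_measurable_def by (intro exI[where x = "\<lambda>i s. h (u i s) (v i s)"]) simp
qed

lemma strongly_measurable_compose:
  assumes "continuous_on UNIV h" "h 0 = 0" "strongly_measurable M f"
  shows "strongly_measurable M (\<lambda>s. h (f s))"
proof -
  have "continuous_on UNIV (\<lambda>(x, y). h x)"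
    using continuous_on_compose2[OF assms(1) continuous_on_fst[OF continuous_on_id]]
    by (simp add: case_prod_unfold)
  from strongly_measurable_compose2[OF this assms(2) assms(3) assms(3)] show ?thesis by simp
qed

lemma strongly_measurable_zero: "strongly_measurable M (\<lambda>_. 0)"
  unfolding strongly_measurable_def
  by (intro exI[where x = "\<lambda>_ _. 0"])
    (auto intro!: Bochner_Integration.simple_bochner_integrable.intros)

text \<open>Members of a class need only agree with one another almost everywhere; completeness makes the
  real functions derived from them measurable.\<close>

lemma (in complete_measure) borel_measurable_AE_cong:
  fixes f g :: "'a \<Rightarrow> real"
  assumes f: "f \<in> borel_measurable M" and eq: "AE s in M. f s = g s"
  shows "g \<in> borel_measurable M"
proof (rule measurableI)
  fix A :: "real set" assume "A \<in> sets borel"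
  show "g -` A \<inter> space M \<in> sets M"
  proof (rule in_sets_AE)
    show "f -` A \<inter> space M \<in> sets M" using f \<open>A \<in> sets borel\<close> by (rule measurable_sets)
    show "AE s in M. (s \<in> f -` A \<inter> space M) = (s \<in> g -` A \<inter> space M)"
      using eq by eventually_elim auto
  qed auto
qed auto

lemma (in complete_measure) strongly_measurable_imp_borel_measurable:
  fixes f :: "'a \<Rightarrow> real"
  assumes "strongly_measurable M f"
  shows "f \<in> borel_measurable M"
proof -
  obtain u where u: "\<And>i::nat. Bochner_Integration.simple_bochner_integrable M (u i)"
    "AE s in M. (\<lambda>i. u i s) \<longlonglongrightarrow> f s"
    using assms unfolding strongly_measurable_def by blast
  have [measurable]: "u i \<in> borel_measurable M" for i
    using u(1)[of i] by (auto elim!: Bochner_Integration.simple_bochner_integrable.cases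
        intro: borel_measurable_simple_function)
  have "(\<lambda>s. lim (\<lambda>i. u i s)) \<in> borel_measurable M" by measurable
  moreover have "AE s in M. lim (\<lambda>i. u i s) = f s"
    using u(2) by eventually_elim (rule limI)
  ultimately show ?thesis by (rule borel_measurable_AE_cong)
qed

section \<open>Functions representing classes\<close>

definition p_integrable :: "'a measure \<Rightarrow> real \<Rightarrow> ('a \<Rightarrow> 'b::real_normed_vector) \<Rightarrow> bool" where
  "p_integrable M p f \<longleftrightarrow> strongly_measurable M f \<and> integrable M (\<lambda>s. norm (f s) powr p)"

lemma (in complete_measure) borel_measurable_norm_powr:
  assumes "strongly_measurable M f"
  shows "(\<lambda>s. norm (f s) powr p) \<in> borel_measurable M"
proof -
  have "strongly_measurable M (\<lambda>s. norm (f s))"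
    by (rule strongly_measurable_compose[OF _ _ assms]) (auto intro: continuous_intros)
  then have "(\<lambda>s. norm (f s)) \<in> borel_measurable M"
    by (rule strongly_measurable_imp_borel_measurable)
  then show ?thesis by measurable
qed

lemma (in complete_measure) borel_measurable_dual_pairing:
  fixes \<phi> :: "'a \<Rightarrow> 'b::real_normed_vector \<Rightarrow>\<^sub>L real"
  assumes "strongly_measurable M \<phi>" "strongly_measurable M f"
  shows "(\<lambda>s. blinfun_apply (\<phi> s) (f s)) \<in> borel_measurable M"
  by (rule strongly_measurable_imp_borel_measurable[OF strongly_measurable_compose2[OF _ _ assms]])
    (auto simp: case_prod_unfold intro!: continuous_intros)

lemma (in complete_measure) p_integrable_AE_cong:
  assumes f: "p_integrable M p f" and eq: "AE s in M. f s = g s"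
  shows "p_integrable M p g"
proof -
  have g: "strongly_measurable M g"
    using strongly_measurable_AE_cong f eq unfolding p_integrable_def by blast
  have "integrable M (\<lambda>s. norm (g s) powr p)"
  proof (rule integrable_cong_AE_imp)
    show "integrable M (\<lambda>s. norm (f s) powr p)" using f by (simp add: p_integrable_def)
    show "AE s in M. norm (f s) powr p = norm (g s) powr p" using eq by eventually_elim simp
  qed (rule borel_measurable_norm_powr[OF g])
  with g show ?thesis by (simp add: p_integrable_def)
qed

lemma mem_ae_class: "g \<in> ae_class M f \<longleftrightarrow> (AE s in M. f s = g s)"
  by (simp add: ae_class_def ae_eq_def)

lemma ae_class_eq_iff: "ae_class M f = ae_class M g \<longleftrightarrow> (AE s in M. f s = g s)"
proof
  assume "ae_class M f = ae_class M g"
  moreover have "g \<in> ae_class M g" by (simp add: mem_ae_class)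
  ultimately show "AE s in M. f s = g s" by (simp add: mem_ae_class flip: mem_ae_class)
next
  assume eq: "AE s in M. f s = g s"
  show "ae_class M f = ae_class M g"
  proof (intro set_eqI iffI)
    fix h assume "h \<in> ae_class M f"
    then have "AE s in M. f s = h s" by (simp add: mem_ae_class)
    with eq have "AE s in M. g s = h s" by eventually_elim simp
    then show "h \<in> ae_class M g" by (simp add: mem_ae_class)
  next
    fix h assume "h \<in> ae_class M g"
    then have "AE s in M. g s = h s" by (simp add: mem_ae_class)
    with eq have "AE s in M. f s = h s" by eventually_elim simp
    then show "h \<in> ae_class M f" by (simp add: mem_ae_class)
  qed
qed

lemma rep_ae_class: "AE s in M. f s = rep (ae_class M f) s"
proof -
  have "f \<in> ae_class M f" by (simp add: mem_ae_class)
  then have "rep (ae_class M f) \<in> ae_class M f" unfolding rep_def by (rule someI[where P = "\<lambda>g. g \<in> ae_class M f"])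
  then show ?thesis by (simp add: mem_ae_class)
qed

lemma ae_class_in_Lp: "p_integrable M p f \<Longrightarrow> ae_class M f \<in> Lp M p"
  unfolding Lp_def p_integrable_def ae_class_def by (rule quotientI) simp

lemma (in complete_measure) Lp_rep:
  assumes "F \<in> Lp M p"
  shows "p_integrable M p (rep F)" and "ae_class M (rep F) = F"
proof -
  obtain f where f: "p_integrable M p f" "F = ae_class M f"
    using assms unfolding Lp_def p_integrable_def ae_class_def by (auto elim!: quotientE)
  have eq: "AE s in M. f s = rep F s" using rep_ae_class f(2) by metis
  show "p_integrable M p (rep F)" using f(1) eq by (rule p_integrable_AE_cong)
  show "ae_class M (rep F) = F" using eq f(2) ae_class_eq_iff by metis
qed

lemma (in complete_measure) Lp_norm_ae_class:
  assumes "p_integrable M p f"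
  shows "Lp_norm M p (ae_class M f) = (\<integral>s. norm (f s) powr p \<partial>M) powr (1 / p)"
proof -
  have eq: "AE s in M. f s = rep (ae_class M f) s" by (rule rep_ae_class)
  have g: "p_integrable M p (rep (ae_class M f))" using assms eq by (rule p_integrable_AE_cong)
  have "(\<integral>s. norm (rep (ae_class M f) s) powr p \<partial>M) = (\<integral>s. norm (f s) powr p \<partial>M)"
  proof (rule integral_cong_AE)
    show "AE s in M. norm (rep (ae_class M f) s) powr p = norm (f s) powr p"
      using eq by eventually_elim simp
  qed (use assms g in \<open>auto simp: p_integrable_def intro: borel_measurable_norm_powr\<close>)
  then show ?thesis by (simp add: Lp_norm_def)
qed

lemma (in complete_measure) Lp_pairing_ae_class:
  assumes "p_integrable M q \<phi>" "p_integrable M p f"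
  shows "Lp_pairing M (ae_class M \<phi>) (ae_class M f) = (\<integral>s. blinfun_apply (\<phi> s) (f s) \<partial>M)"
proof -
  have eq: "AE s in M. \<phi> s = rep (ae_class M \<phi>) s" "AE s in M. f s = rep (ae_class M f) s"
    by (rule rep_ae_class)+
  have g: "p_integrable M q (rep (ae_class M \<phi>))" "p_integrable M p (rep (ae_class M f))"
    using p_integrable_AE_cong assms eq by blast+
  show ?thesis unfolding Lp_pairing_def
  proof (rule integral_cong_AE)
    show "AE s in M. blinfun_apply (rep (ae_class M \<phi>) s) (rep (ae_class M f) s) = blinfun_apply (\<phi> s) (f s)"
      using eq by eventually_elim simp
  qed (use assms g in \<open>auto simp: p_integrable_def intro: borel_measurable_dual_pairing\<close>)
qed

lemma p_integrable_zero: "p_integrable M p (\<lambda>_. 0)"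
  by (simp add: p_integrable_def strongly_measurable_zero)

lemma p_integrable_scale:
  assumes "p_integrable M p f"
  shows "p_integrable M p (\<lambda>s. t *\<^sub>R f s)"
proof -
  have "strongly_measurable M (\<lambda>s. t *\<^sub>R f s)"
    by (rule strongly_measurable_compose[where h = "\<lambda>x. t *\<^sub>R x"])
      (use assms in \<open>auto simp: p_integrable_def intro: continuous_intros\<close>)
  moreover have "integrable M (\<lambda>s. norm (t *\<^sub>R f s) powr p)"
    using assms by (simp add: p_integrable_def powr_mult)
  ultimately show ?thesis by (simp add: p_integrable_def)
qed

text \<open>For conjugate exponents \<open>(p - 1) q = p\<close>, so that the \<open>q\<close>-th power of \<open>\<parallel>K x\<parallel>\<close> is the \<open>p\<close>-th
  power of \<open>\<parallel>x\<parallel>\<close>: the gauge map preserves the integrals defining the norms.\<close>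

lemma p_integrable_gauge_map:
  fixes K :: "'b::real_normed_vector \<Rightarrow> 'c::real_normed_vector"
  assumes K: "continuous_on UNIV K" "\<And>x. norm (K x) = norm x powr (p - 1)"
    and pq: "(p - 1) * q = p" and f: "p_integrable M p f"
  shows "p_integrable M q (\<lambda>s. K (f s))"
    and "norm (K (f s)) powr q = norm (f s) powr p"
proof -
  show *: "norm (K (f s)) powr q = norm (f s) powr p" for s
    by (simp add: K(2) powr_powr pq)
  have "norm (K 0) = 0" by (simp add: K(2))
  then have "strongly_measurable M (\<lambda>s. K (f s))"
    using K(1) f unfolding p_integrable_def by (intro strongly_measurable_compose[where h = K]) auto
  then show "p_integrable M q (\<lambda>s. K (f s))" using f by (simp add: p_integrable_def *)
qed

section \<open>Norm and pairing on classes\<close>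

context complete_measure
begin

lemma Lp_zero_in_Lp: "Lp_zero M \<in> Lp M p"
  unfolding Lp_zero_def by (intro ae_class_in_Lp p_integrable_zero)

lemma Lp_norm_zero: "Lp_norm M p (Lp_zero M) = 0"
  unfolding Lp_zero_def by (subst Lp_norm_ae_class) (auto simp: p_integrable_zero)

lemma Lp_norm_nonneg: "0 \<le> Lp_norm M p F"
  by (simp add: Lp_norm_def)

lemma integral_rep_powr:
  assumes "0 < p"
  shows "(\<integral>s. norm (rep F s) powr p \<partial>M) = Lp_norm M p F powr p"
  using assms by (simp add: Lp_norm_def powr_powr)

lemma Lp_norm_eq_0_iff:
  assumes "F \<in> Lp M p" "0 < p"
  shows "Lp_norm M p F = 0 \<longleftrightarrow> F = Lp_zero M"
proof
  assume "Lp_norm M p F = 0"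
  then have "(\<integral>s. norm (rep F s) powr p \<partial>M) = 0"
    using integral_rep_powr[OF assms(2), of F] by simp
  then have "AE s in M. norm (rep F s) powr p = 0"
    using integral_nonneg_eq_0_iff_AE[of M "\<lambda>s. norm (rep F s) powr p"] Lp_rep(1)[OF assms(1)]
    by (simp add: p_integrable_def)
  then have "ae_class M (rep F) = Lp_zero M"
    unfolding Lp_zero_def ae_class_eq_iff by eventually_elim (simp add: powr_eq_0_iff)
  then show "F = Lp_zero M" using Lp_rep(2)[OF assms(1)] by simp
qed (simp add: Lp_norm_zero)

lemma Lp_scale_in_Lp: "F \<in> Lp M p \<Longrightarrow> Lp_scale M t F \<in> Lp M p"
  unfolding Lp_scale_def by (intro ae_class_in_Lp p_integrable_scale Lp_rep(1))

lemma Lp_norm_scale: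
  assumes "F \<in> Lp M p" "0 < p"
  shows "Lp_norm M p (Lp_scale M t F) = \<bar>t\<bar> * Lp_norm M p F"
proof -
  have "Lp_norm M p (Lp_scale M t F) = (\<integral>s. norm (t *\<^sub>R rep F s) powr p \<partial>M) powr (1 / p)"
    unfolding Lp_scale_def by (intro Lp_norm_ae_class p_integrable_scale Lp_rep(1) assms)
  also have "\<dots> = (\<bar>t\<bar> powr p * (\<integral>s. norm (rep F s) powr p \<partial>M)) powr (1 / p)"
    by (simp add: powr_mult)
  also have "\<dots> = \<bar>t\<bar> * Lp_norm M p F"
    using assms(2) by (simp add: powr_mult powr_powr Lp_norm_def)
  finally show ?thesis .
qed

lemma Lp_scale_scale: "Lp_scale M s (Lp_scale M t F) = Lp_scale M (s * t) F"
proof -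
  have "AE x in M. t *\<^sub>R rep F x = rep (Lp_scale M t F) x"
    unfolding Lp_scale_def by (rule rep_ae_class)
  then have "AE x in M. s *\<^sub>R rep (Lp_scale M t F) x = (s * t) *\<^sub>R rep F x"
    by eventually_elim (metis scaleR_scaleR)
  then show ?thesis by (simp add: Lp_scale_def[of M s] Lp_scale_def[of M "s * t"] ae_class_eq_iff)
qed

lemma Lp_scale_one: "F \<in> Lp M p \<Longrightarrow> Lp_scale M 1 F = F"
  by (simp add: Lp_scale_def Lp_rep(2))

lemma Lp_scale_0: "Lp_scale M 0 F = Lp_zero M"
  by (simp add: Lp_scale_def Lp_zero_def)

lemma Lp_scale_diff: "Lp_diff M (Lp_scale M s F) (Lp_scale M t F) = Lp_scale M (s - t) F"
proof -
  have "AE x in M. s *\<^sub>R rep F x = rep (Lp_scale M s F) x"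
    "AE x in M. t *\<^sub>R rep F x = rep (Lp_scale M t F) x"
    unfolding Lp_scale_def by (rule rep_ae_class)+
  then have "AE x in M. rep (Lp_scale M s F) x - rep (Lp_scale M t F) x = (s - t) *\<^sub>R rep F x"
    by eventually_elim (metis scaleR_diff_left)
  then show ?thesis by (simp add: Lp_diff_def Lp_scale_def[of M "s - t"] ae_class_eq_iff)
qed

lemma Lp_pairing_scale_left:
  assumes "\<Phi> \<in> Lp M q" "F \<in> Lp M p"
  shows "Lp_pairing M (Lp_scale M t \<Phi>) F = t * Lp_pairing M \<Phi> F"
proof -
  have "Lp_pairing M (Lp_scale M t \<Phi>) (ae_class M (rep F)) = (\<integral>s. blinfun_apply (t *\<^sub>R rep \<Phi> s) (rep F s) \<partial>M)"
    unfolding Lp_scale_def by (intro Lp_pairing_ae_class[where q = q and p = p] p_integrable_scale Lp_rep(1) assms)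
  then show ?thesis using Lp_rep(2)[OF assms(2)] by (simp add: blinfun.scaleR_left Lp_pairing_def)
qed

lemma Lp_pairing_scale_right:
  assumes "\<Phi> \<in> Lp M q" "F \<in> Lp M p"
  shows "Lp_pairing M \<Phi> (Lp_scale M t F) = t * Lp_pairing M \<Phi> F"
proof -
  have "Lp_pairing M (ae_class M (rep \<Phi>)) (Lp_scale M t F) = (\<integral>s. blinfun_apply (rep \<Phi> s) (t *\<^sub>R rep F s) \<partial>M)"
    unfolding Lp_scale_def by (intro Lp_pairing_ae_class[where q = q and p = p] p_integrable_scale Lp_rep(1) assms)
  then show ?thesis using Lp_rep(2)[OF assms(1)] by (simp add: blinfun.scaleR_right Lp_pairing_def)
qed

lemma Lp_pairing_zero_left: "F \<in> Lp M p \<Longrightarrow> Lp_pairing M (Lp_zero M) F = 0"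
  using Lp_pairing_scale_left[OF Lp_zero_in_Lp, of F p 0] by (simp add: Lp_scale_0)

lemma Lp_pairing_zero_right: "\<Phi> \<in> Lp M q \<Longrightarrow> Lp_pairing M \<Phi> (Lp_zero M) = 0"
  using Lp_pairing_scale_right[OF _ Lp_zero_in_Lp, of \<Phi> q 0] by (simp add: Lp_scale_0)

end

section \<open>The Hoelder inequality and its equality case\<close>

locale conjugate_exponents = complete_measure M for M :: "'a measure" +
  fixes p q :: real
  assumes p_gt_1: "1 < p" and q_gt_1: "1 < q" and conjugate: "1 / p + 1 / q = 1"
begin

lemma pos: "0 < p" "0 < q"
  using p_gt_1 q_gt_1 by auto

lemma exponent_identities: "(p - 1) * q = p" "(q - 1) * p = q"
proof -
  have "p + q = p * q" using conjugate pos by (simp add: field_simps)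
  then show "(p - 1) * q = p" "(q - 1) * p = q" by (simp_all add: algebra_simps)
qed

lemma Youngs_pairing:
  fixes \<phi> :: "'b::real_normed_vector \<Rightarrow>\<^sub>L real"
  shows "\<bar>blinfun_apply \<phi> x\<bar> \<le> norm \<phi> powr q / q + norm x powr p / p"
proof -
  have "\<bar>blinfun_apply \<phi> x\<bar> \<le> norm \<phi> * norm x"
    using norm_blinfun[of \<phi> x] by simp
  also have "\<dots> \<le> norm \<phi> powr q / q + norm x powr p / p"
    using p_gt_1 q_gt_1 conjugate by (intro Youngs_inequality) auto
  finally show ?thesis .
qed

lemma Youngs_pairing_eq:
  fixes \<phi> :: "'b::real_normed_vector \<Rightarrow>\<^sub>L real"
  assumes eq: "blinfun_apply \<phi> x = norm \<phi> powr q / q + norm x powr p / p"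
  shows "norm \<phi> powr q = norm x powr p" and "blinfun_apply \<phi> x = norm \<phi> * norm x"
proof -
  have "blinfun_apply \<phi> x \<le> norm \<phi> * norm x"
    using norm_blinfun[of \<phi> x] by simp
  moreover have "norm \<phi> * norm x \<le> norm \<phi> powr q / q + norm x powr p / p"
    using p_gt_1 q_gt_1 conjugate by (intro Youngs_inequality) auto
  ultimately show *: "blinfun_apply \<phi> x = norm \<phi> * norm x" using eq by simp
  show "norm \<phi> powr q = norm x powr p"
    using p_gt_1 q_gt_1 conjugate eq * by (intro Youngs_equality) auto
qed

lemma integrable_dual_pairing:
  fixes \<phi> :: "'a \<Rightarrow> 'b::real_normed_vector \<Rightarrow>\<^sub>L real"
  assumes "p_integrable M q \<phi>" "p_integrable M p f"
  shows "integrable M (\<lambda>s. blinfun_apply (\<phi> s) (f s))"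
proof (rule Bochner_Integration.integrable_bound)
  show "integrable M (\<lambda>s. norm (\<phi> s) powr q / q + norm (f s) powr p / p)"
    using assms by (simp add: p_integrable_def)
  show "AE s in M. norm (blinfun_apply (\<phi> s) (f s)) \<le> norm (norm (\<phi> s) powr q / q + norm (f s) powr p / p)"
    using Youngs_pairing pos by (intro AE_I2) force
  show "(\<lambda>s. blinfun_apply (\<phi> s) (f s)) \<in> borel_measurable M"
    using assms by (intro borel_measurable_dual_pairing) (auto simp: p_integrable_def)
qed

text \<open>Integrating the Young inequality pointwise gives the bound, since both power integrals are \<open>1\<close>
  and \<open>1 / p + 1 / q = 1\<close>. In case of equality the nonnegative defect in the Young inequality
  has integral \<open>0\<close>, so that it vanishes almost everywhere.\<close>

lemma unit_pairing:
  assumes F: "F \<in> Lp M p" "Lp_norm M p F = 1" and \<Phi>: "\<Phi> \<in> Lp M q" "Lp_norm M q \<Phi> = 1"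
  shows "Lp_pairing M \<Phi> F \<le> 1"
    and "Lp_pairing M \<Phi> F = 1 \<Longrightarrow> AE s in M. norm (rep \<Phi> s) powr q = norm (rep F s) powr p \<and>
      blinfun_apply (rep \<Phi> s) (rep F s) = norm (rep \<Phi> s) * norm (rep F s)"
proof -
  let ?d = "\<lambda>s. norm (rep \<Phi> s) powr q / q + norm (rep F s) powr p / p - blinfun_apply (rep \<Phi> s) (rep F s)"
  have int: "integrable M (\<lambda>s. norm (rep \<Phi> s) powr q)" "integrable M (\<lambda>s. norm (rep F s) powr p)"
    "integrable M (\<lambda>s. blinfun_apply (rep \<Phi> s) (rep F s))"
    using Lp_rep(1)[OF F(1)] Lp_rep(1)[OF \<Phi>(1)] integrable_dual_pairing by (auto simp: p_integrable_def)
  have "integral\<^sup>L M ?d = 1 / q + 1 / p - Lp_pairing M \<Phi> F"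
    using int integral_rep_powr[OF pos(1), of F] integral_rep_powr[OF pos(2), of \<Phi>] F(2) \<Phi>(2)
    by (simp add: Lp_pairing_def)
  then have d: "integral\<^sup>L M ?d = 1 - Lp_pairing M \<Phi> F"
    using conjugate by simp
  have nonneg: "0 \<le> ?d s" for s
    using Youngs_pairing[of "rep \<Phi> s" "rep F s"] by simp
  then have "0 \<le> integral\<^sup>L M ?d" by (rule Bochner_Integration.integral_nonneg)
  then show "Lp_pairing M \<Phi> F \<le> 1" using d by simp
  assume "Lp_pairing M \<Phi> F = 1"
  then have "AE s in M. ?d s = 0"
    using d integral_nonneg_eq_0_iff_AE[of M ?d] nonneg int by simp
  then show "AE s in M. norm (rep \<Phi> s) powr q = norm (rep F s) powr p \<and>
      blinfun_apply (rep \<Phi> s) (rep F s) = norm (rep \<Phi> s) * norm (rep F s)"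
  proof eventually_elim
    case (elim s)
    then have "blinfun_apply (rep \<Phi> s) (rep F s) = norm (rep \<Phi> s) powr q / q + norm (rep F s) powr p / p"
      by simp
    from Youngs_pairing_eq[OF this] show ?case by simp
  qed
qed

lemma Lp_normalize:
  assumes "F \<in> Lp M p'" "0 < p'" "Lp_norm M p' F \<noteq> 0"
  shows "Lp_scale M (1 / Lp_norm M p' F) F \<in> Lp M p'"
    and "Lp_norm M p' (Lp_scale M (1 / Lp_norm M p' F) F) = 1"
    and "Lp_scale M (Lp_norm M p' F) (Lp_scale M (1 / Lp_norm M p' F) F) = F"
  using assms Lp_norm_nonneg[of p' F]
  by (auto simp: Lp_scale_in_Lp Lp_norm_scale Lp_scale_scale Lp_scale_one)

lemma Holder_pairing:
  assumes F: "F \<in> Lp M p" and \<Phi>: "\<Phi> \<in> Lp M q"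
  shows "Lp_pairing M \<Phi> F \<le> Lp_norm M q \<Phi> * Lp_norm M p F"
proof (cases "Lp_norm M q \<Phi> = 0 \<or> Lp_norm M p F = 0")
  case True
  then have "\<Phi> = Lp_zero M \<or> F = Lp_zero M" using Lp_norm_eq_0_iff[OF \<Phi> pos(2)] Lp_norm_eq_0_iff[OF F pos(1)] by simp
  then show ?thesis using Lp_pairing_zero_left[OF F] Lp_pairing_zero_right[OF \<Phi>]
    by (auto simp: Lp_norm_zero)
next
  case False
  then have n: "0 < Lp_norm M q \<Phi>" "0 < Lp_norm M p F"
    using Lp_norm_nonneg[of q \<Phi>] Lp_norm_nonneg[of p F] by auto
  have "Lp_pairing M (Lp_scale M (1 / Lp_norm M q \<Phi>) \<Phi>) (Lp_scale M (1 / Lp_norm M p F) F) \<le> 1"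
    using n by (intro unit_pairing(1) Lp_normalize F \<Phi> pos) auto
  then show ?thesis
    using n by (simp add: Lp_pairing_scale_left[OF \<Phi> Lp_scale_in_Lp[OF F]] 
        Lp_pairing_scale_right[OF \<Phi> F] field_simps)
qed

text \<open>After normalization, equality in the Hoelder inequality determines almost everywhere the norm
  of the functional from that of the point and makes the functional support the point;
  smoothness of the value space leaves one choice for its value.\<close>

lemma support_functional_unique:
  fixes F :: "('a \<Rightarrow> 'b::real_normed_vector) set"
  assumes smooth: "uniformly_smooth TYPE('b)"
    and F: "F \<in> Lp M p" "Lp_norm M p F \<noteq> 0" and \<Phi>: "\<Phi> \<in> Lp M q" and \<Psi>: "\<Psi> \<in> Lp M q"
    and eq: "Lp_norm M q \<Phi> = Lp_norm M q \<Psi>"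
      "Lp_pairing M \<Phi> F = Lp_norm M q \<Phi> * Lp_norm M p F" "Lp_pairing M \<Psi> F = Lp_norm M q \<Psi> * Lp_norm M p F"
  shows "\<Phi> = \<Psi>"
proof (cases "Lp_norm M q \<Phi> = 0")
  case True
  then show ?thesis using eq(1) Lp_norm_eq_0_iff[OF \<Phi> pos(2)] Lp_norm_eq_0_iff[OF \<Psi> pos(2)] by simp
next
  case False
  define U where "U = Lp_scale M (1 / Lp_norm M p F) F"
  define \<Phi>' where "\<Phi>' = Lp_scale M (1 / Lp_norm M q \<Phi>) \<Phi>"
  define \<Psi>' where "\<Psi>' = Lp_scale M (1 / Lp_norm M q \<Psi>) \<Psi>"
  have False': "Lp_norm M q \<Psi> \<noteq> 0" using False eq(1) by simp
  note U = Lp_normalize[OF F(1) pos(1) F(2), folded U_def]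
  note \<Phi>' = Lp_normalize[OF \<Phi> pos(2) False, folded \<Phi>'_def]
  note \<Psi>' = Lp_normalize[OF \<Psi> pos(2) False', folded \<Psi>'_def]
  have 1: "Lp_pairing M \<Phi>' U = 1" "Lp_pairing M \<Psi>' U = 1"
    using False False' F(2) eq(2,3) unfolding \<Phi>'_def \<Psi>'_def U_def
    by (simp_all add: Lp_pairing_scale_left[OF \<Phi> Lp_scale_in_Lp[OF F(1)]]
        Lp_pairing_scale_left[OF \<Psi> Lp_scale_in_Lp[OF F(1)]]
        Lp_pairing_scale_right[OF \<Phi> F(1)] Lp_pairing_scale_right[OF \<Psi> F(1)])
  have "AE s in M. rep \<Phi>' s = rep \<Psi>' s"
    using unit_pairing(2)[OF U(1,2) \<Phi>'(1,2) 1(1)] unit_pairing(2)[OF U(1,2) \<Psi>'(1,2) 1(2)]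
  proof eventually_elim
    case (elim s)
    then have "(norm (rep \<Phi>' s) powr q) powr (1 / q) = (norm (rep \<Psi>' s) powr q) powr (1 / q)" by metis
    then have n: "norm (rep \<Phi>' s) = norm (rep \<Psi>' s)" using pos by (simp add: powr_powr)
    have "rep \<Phi>' s = 0" if "rep U s = 0" using elim that by simp
    then show ?case
      by (rule smooth_support_unique[OF smooth n conjunct2[OF elim(1)] conjunct2[OF elim(2)]])
  qed
  then have "\<Phi>' = \<Psi>'" using Lp_rep(2)[OF \<Phi>'(1)] Lp_rep(2)[OF \<Psi>'(1)] ae_class_eq_iff by metis
  then show ?thesis using \<Phi>'(3) \<Psi>'(3) eq(1) by metis
qed

text \<open>Dually, the norm of the point is determined almost everywhere, and the convexity of the value
  space leaves one point of that norm that the functional supports.\<close>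

lemma support_point_unique:
  fixes F G :: "('a \<Rightarrow> 'b::real_normed_vector) set"
  assumes convex: "uniformly_convex TYPE('b)"
    and \<Phi>: "\<Phi> \<in> Lp M q" "Lp_norm M q \<Phi> \<noteq> 0" and F: "F \<in> Lp M p" and G: "G \<in> Lp M p"
    and eq: "Lp_norm M p F = Lp_norm M p G"
      "Lp_pairing M \<Phi> F = Lp_norm M q \<Phi> * Lp_norm M p F" "Lp_pairing M \<Phi> G = Lp_norm M q \<Phi> * Lp_norm M p G"
  shows "F = G"
proof (cases "Lp_norm M p F = 0")
  case True
  then show ?thesis using eq(1) Lp_norm_eq_0_iff[OF F pos(1)] Lp_norm_eq_0_iff[OF G pos(1)] by simp
next
  case False
  define \<Psi> where "\<Psi> = Lp_scale M (1 / Lp_norm M q \<Phi>) \<Phi>"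
  define F' where "F' = Lp_scale M (1 / Lp_norm M p F) F"
  define G' where "G' = Lp_scale M (1 / Lp_norm M p G) G"
  have False': "Lp_norm M p G \<noteq> 0" using False eq(1) by simp
  note \<Psi> = Lp_normalize[OF \<Phi>(1) pos(2) \<Phi>(2), folded \<Psi>_def]
  note F' = Lp_normalize[OF F pos(1) False, folded F'_def]
  note G' = Lp_normalize[OF G pos(1) False', folded G'_def]
  have 1: "Lp_pairing M \<Psi> F' = 1" "Lp_pairing M \<Psi> G' = 1"
    using False False' \<Phi>(2) eq(2,3) unfolding F'_def G'_def \<Psi>_def
    by (simp_all add: Lp_pairing_scale_left[OF \<Phi>(1) Lp_scale_in_Lp[OF F]]
        Lp_pairing_scale_left[OF \<Phi>(1) Lp_scale_in_Lp[OF G]]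
        Lp_pairing_scale_right[OF \<Phi>(1) F] Lp_pairing_scale_right[OF \<Phi>(1) G])
  have "AE s in M. rep F' s = rep G' s"
    using unit_pairing(2)[OF F'(1,2) \<Psi>(1,2) 1(1)] unit_pairing(2)[OF G'(1,2) \<Psi>(1,2) 1(2)]
  proof eventually_elim
    case (elim s)
    then have "(norm (rep F' s) powr p) powr (1 / p) = (norm (rep G' s) powr p) powr (1 / p)" by metis
    then have n: "norm (rep F' s) = norm (rep G' s)" using pos by (simp add: powr_powr)
    have "rep F' s = 0" if "rep \<Psi> s = 0" using elim that by simp
    then show ?case
      by (rule convex_maximizer_unique[OF convex n conjunct2[OF elim(1)] conjunct2[OF elim(2)]])
  qed
  then have "F' = G'" using Lp_rep(2)[OF F'(1)] Lp_rep(2)[OF G'(1)] ae_class_eq_iff by metis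
  then show ?thesis using F'(3) G'(3) eq(1) by metis
qed

text \<open>The functional is the pointwise duality mapping with gauge \<open>t\<^sup>p\<^sup>-\<^sup>1\<close> applied to a
  representative of \<open>F\<close>.\<close>

lemma unit_support_functional_exists:
  fixes F :: "('a \<Rightarrow> 'b::real_normed_vector) set"
  assumes smooth: "uniformly_smooth TYPE('b)" and F: "F \<in> Lp M p" "Lp_norm M p F = 1"
  shows "\<exists>\<Phi>\<in>Lp M q. Lp_norm M q \<Phi> = 1 \<and> Lp_pairing M \<Phi> F = 1"
proof -
  obtain K :: "'b \<Rightarrow> ('b \<Rightarrow>\<^sub>L real)"
    where K: "continuous_on UNIV K" "\<And>x. norm (K x) = norm x powr (p - 1)"
      "\<And>x. blinfun_apply (K x) x = norm x powr p"
    using smooth_gauge_map[OF smooth p_gt_1] by metis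
  note f = Lp_rep[OF F(1)]
  note Kf = p_integrable_gauge_map[OF K(1,2) exponent_identities(1) f(1)]
  have 1: "(\<integral>s. norm (rep F s) powr p \<partial>M) = 1"
    using integral_rep_powr[OF pos(1), of F] F(2) by simp
  have "Lp_norm M q (ae_class M (\<lambda>s. K (rep F s))) = 1"
    by (simp add: Lp_norm_ae_class[OF Kf(1)] Kf(2) 1)
  moreover have "Lp_pairing M (ae_class M (\<lambda>s. K (rep F s))) F = 1"
    using Lp_pairing_ae_class[OF Kf(1) f(1)] f(2) by (simp add: K(3) 1)
  ultimately show ?thesis using ae_class_in_Lp[OF Kf(1)] by blast
qed

text \<open>Attainment of norms for \<open>L\<^sub>q\<close> functionals: the maximizer is chosen pointwise, and the
  continuity of the choice makes it strongly measurable.\<close>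

lemma unit_support_point_exists:
  fixes \<Phi> :: "('a \<Rightarrow> ('b::banach \<Rightarrow>\<^sub>L real)) set"
  assumes convex: "uniformly_convex TYPE('b)" and \<Phi>: "\<Phi> \<in> Lp M q" "Lp_norm M q \<Phi> = 1"
  shows "\<exists>F\<in>Lp M p. Lp_norm M p F = 1 \<and> Lp_pairing M \<Phi> F = 1"
proof -
  obtain K :: "('b \<Rightarrow>\<^sub>L real) \<Rightarrow> 'b"
    where K: "continuous_on UNIV K" "\<And>\<phi>. norm (K \<phi>) = norm \<phi> powr (q - 1)"
      "\<And>\<phi>. blinfun_apply \<phi> (K \<phi>) = norm \<phi> powr q"
    using convex_gauge_map[OF convex q_gt_1] by metis
  note \<phi> = Lp_rep[OF \<Phi>(1)]
  note K\<phi> = p_integrable_gauge_map[OF K(1,2) exponent_identities(2) \<phi>(1)]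
  have 1: "(\<integral>s. norm (rep \<Phi> s) powr q \<partial>M) = 1"
    using integral_rep_powr[OF pos(2), of \<Phi>] \<Phi>(2) by simp
  have "Lp_norm M p (ae_class M (\<lambda>s. K (rep \<Phi> s))) = 1"
    by (simp add: Lp_norm_ae_class[OF K\<phi>(1)] K\<phi>(2) 1)
  moreover have "Lp_pairing M \<Phi> (ae_class M (\<lambda>s. K (rep \<Phi> s))) = 1"
    using Lp_pairing_ae_class[OF \<phi>(1) K\<phi>(1)] \<phi>(2) by (simp add: K(3) 1)
  ultimately show ?thesis using ae_class_in_Lp[OF K\<phi>(1)] by blast
qed

section \<open>The normalized duality mapping\<close>

text \<open>The equations defining the duality mapping amount to equal norms and equality in the
  Hoelder inequality, so that the definite description is determined by uniqueness of support
  functionals.\<close>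

lemma duality_map_eqI:
  fixes F :: "('a \<Rightarrow> 'b::real_normed_vector) set"
  assumes smooth: "uniformly_smooth TYPE('b)" and F: "F \<in> Lp M p"
    and \<Phi>: "\<Phi> \<in> Lp M q" "Lp_norm M q \<Phi> = Lp_norm M p F" "Lp_pairing M \<Phi> F = (Lp_norm M p F)\<^sup>2"
  shows "duality_map M p q F = \<Phi>"
  unfolding duality_map_def
proof (rule the_equality)
  fix \<Psi> assume *: "\<Psi> \<in> Lp M q \<and> Lp_pairing M \<Psi> F = Lp_norm M q \<Psi> * Lp_norm M p F \<and>
        Lp_norm M q \<Psi> * Lp_norm M p F = (Lp_norm M p F)\<^sup>2 \<and> (Lp_norm M p F)\<^sup>2 = (Lp_norm M q \<Psi>)\<^sup>2"
  then have n: "Lp_norm M q \<Psi> = Lp_norm M p F"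
    using Lp_norm_nonneg[of p F] Lp_norm_nonneg[of q \<Psi>] by (simp add: power2_eq_iff_nonneg)
  show "\<Psi> = \<Phi>"
  proof (cases "Lp_norm M p F = 0")
    case True
    then show ?thesis using Lp_norm_eq_0_iff[of _ q] pos * n \<Phi> by metis
  next
    case False
    then show ?thesis
      using * n \<Phi> by (intro support_functional_unique[OF smooth F]) (auto simp: power2_eq_square)
  qed
qed (use \<Phi> in \<open>auto simp: power2_eq_square\<close>)

text \<open>For \<open>F \<noteq> 0\<close> the image is \<open>\<parallel>F\<parallel>\<close> times a unit support functional of the normalized \<open>F\<close>.\<close>

lemma duality_map:
  fixes F :: "('a \<Rightarrow> 'b::real_normed_vector) set"
  assumes smooth: "uniformly_smooth TYPE('b)" and F: "F \<in> Lp M p"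
  shows "duality_map M p q F \<in> Lp M q"
    and "Lp_norm M q (duality_map M p q F) = Lp_norm M p F"
    and "Lp_pairing M (duality_map M p q F) F = (Lp_norm M p F)\<^sup>2"
proof -
  have "\<exists>\<Phi>\<in>Lp M q. Lp_norm M q \<Phi> = Lp_norm M p F \<and> Lp_pairing M \<Phi> F = (Lp_norm M p F)\<^sup>2"
  proof (cases "Lp_norm M p F = 0")
    case True
    then show ?thesis using Lp_zero_in_Lp Lp_norm_zero Lp_pairing_zero_left[OF F] by force
  next
    case False
    define n where "n = Lp_norm M p F"
    have n: "0 < n" using False Lp_norm_nonneg[of p F] by (simp add: n_def)
    note U = Lp_normalize[OF F pos(1) False, folded n_def]
    obtain \<Psi> where \<Psi>: "\<Psi> \<in> Lp M q" "Lp_norm M q \<Psi> = 1" "Lp_pairing M \<Psi> (Lp_scale M (1 / n) F) = 1"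
      using unit_support_functional_exists[OF smooth U(1,2)] by blast
    have "Lp_pairing M \<Psi> F = n" using \<Psi>(3) n by (simp add: Lp_pairing_scale_right[OF \<Psi>(1) F])
    then have "Lp_norm M q (Lp_scale M n \<Psi>) = n" "Lp_pairing M (Lp_scale M n \<Psi>) F = n\<^sup>2"
      using n \<Psi>(2) Lp_norm_scale[OF \<Psi>(1) pos(2)] Lp_pairing_scale_left[OF \<Psi>(1) F]
      by (simp_all add: power2_eq_square)
    then show ?thesis using Lp_scale_in_Lp[OF \<Psi>(1)] unfolding n_def by blast
  qed
  then obtain \<Phi> where \<Phi>: "\<Phi> \<in> Lp M q" "Lp_norm M q \<Phi> = Lp_norm M p F" "Lp_pairing M \<Phi> F = (Lp_norm M p F)\<^sup>2"
    by blast
  then have "duality_map M p q F = \<Phi>" using duality_map_eqI[OF smooth F] by blast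
  then show "duality_map M p q F \<in> Lp M q" "Lp_norm M q (duality_map M p q F) = Lp_norm M p F"
    "Lp_pairing M (duality_map M p q F) F = (Lp_norm M p F)\<^sup>2" using \<Phi> by simp_all
qed

lemma duality_map_scale:
  fixes F :: "('a \<Rightarrow> 'b::real_normed_vector) set"
  assumes smooth: "uniformly_smooth TYPE('b)" and F: "F \<in> Lp M p"
  shows "duality_map M p q (Lp_scale M t F) = Lp_scale M t (duality_map M p q F)"
proof (rule duality_map_eqI[OF smooth Lp_scale_in_Lp[OF F]])
  note J = duality_map[OF smooth F]
  show "Lp_scale M t (duality_map M p q F) \<in> Lp M q" using J(1) by (rule Lp_scale_in_Lp)
  show "Lp_norm M q (Lp_scale M t (duality_map M p q F)) = Lp_norm M p (Lp_scale M t F)"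
    by (simp add: Lp_norm_scale[OF J(1) pos(2)] Lp_norm_scale[OF F pos(1)] J(2))
  show "Lp_pairing M (Lp_scale M t (duality_map M p q F)) (Lp_scale M t F) = (Lp_norm M p (Lp_scale M t F))\<^sup>2"
    by (simp add: Lp_pairing_scale_left[OF J(1) Lp_scale_in_Lp[OF F]] Lp_pairing_scale_right[OF J(1) F]
        Lp_norm_scale[OF F pos(1)] J(3) power2_eq_square)
qed

text \<open>Both points have the norm of their common image, and this image supports both.\<close>

lemma duality_map_inj:
  fixes F G :: "('a \<Rightarrow> 'b::real_normed_vector) set"
  assumes convex: "uniformly_convex TYPE('b)" and smooth: "uniformly_smooth TYPE('b)"
    and F: "F \<in> Lp M p" and G: "G \<in> Lp M p" and eq: "duality_map M p q F = duality_map M p q G"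
  shows "F = G"
proof (cases "Lp_norm M p F = 0")
  case True
  moreover have "Lp_norm M p F = Lp_norm M p G"
    using duality_map(2)[OF smooth F] duality_map(2)[OF smooth G] eq by metis
  ultimately show ?thesis
    using Lp_norm_eq_0_iff[OF F pos(1)] Lp_norm_eq_0_iff[OF G pos(1)] by metis
next
  case False
  note J = duality_map[OF smooth F] duality_map[OF smooth G, folded eq]
  show ?thesis
    by (rule support_point_unique[OF convex J(1) _ F G]) (use False J in \<open>simp_all add: power2_eq_square\<close>)
qed

section \<open>Inverse optimality sets of balls\<close>

text \<open>The Hoelder inequality is the upper bound; it is attained at \<open>r\<close> times a unit vector at which
  \<open>\<Phi>\<close> attains its norm.\<close>

lemma SUP_pairing_cball:
  fixes \<Phi> :: "('a \<Rightarrow> ('b::banach \<Rightarrow>\<^sub>L real)) set"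
  assumes convex: "uniformly_convex TYPE('b)" and \<Phi>: "\<Phi> \<in> Lp M q" and "0 < r"
  shows "(SUP F\<in>Lp_cball M p r. ereal (Lp_pairing M \<Phi> F)) = ereal (r * Lp_norm M q \<Phi>)"
proof (rule antisym)
  show "(SUP F\<in>Lp_cball M p r. ereal (Lp_pairing M \<Phi> F)) \<le> ereal (r * Lp_norm M q \<Phi>)"
  proof (rule SUP_least)
    fix F :: "('a \<Rightarrow> 'b) set" assume "F \<in> Lp_cball M p r"
    then have F: "F \<in> Lp M p" "Lp_norm M p F \<le> r" by (auto simp: Lp_cball_def)
    have "Lp_pairing M \<Phi> F \<le> Lp_norm M q \<Phi> * Lp_norm M p F" using F(1) \<Phi> by (rule Holder_pairing)
    also have "\<dots> \<le> Lp_norm M q \<Phi> * r" using F(2) Lp_norm_nonneg by (rule mult_left_mono)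
    finally show "ereal (Lp_pairing M \<Phi> F) \<le> ereal (r * Lp_norm M q \<Phi>)" by (simp add: mult.commute)
  qed
  have "\<exists>F\<in>Lp_cball M p r. Lp_pairing M \<Phi> F = r * Lp_norm M q \<Phi>"
  proof (cases "Lp_norm M q \<Phi> = 0")
    case True
    have "Lp_zero M \<in> Lp_cball M p r"
      using \<open>0 < r\<close> by (simp add: Lp_cball_def Lp_zero_in_Lp Lp_norm_zero)
    then show ?thesis using Lp_pairing_zero_right[OF \<Phi>] True by force
  next
    case False
    note U = Lp_normalize[OF \<Phi> pos(2) False]
    obtain F where F: "F \<in> Lp M p" "Lp_norm M p F = 1"
      "Lp_pairing M (Lp_scale M (1 / Lp_norm M q \<Phi>) \<Phi>) F = 1"
      using unit_support_point_exists[OF convex U(1,2)] by blast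
    have "Lp_pairing M \<Phi> F = Lp_norm M q \<Phi>"
      using F(3) False by (simp add: Lp_pairing_scale_left[OF \<Phi> F(1)])
    then have "Lp_pairing M \<Phi> (Lp_scale M r F) = r * Lp_norm M q \<Phi>"
      by (simp add: Lp_pairing_scale_right[OF \<Phi> F(1)])
    moreover have "Lp_scale M r F \<in> Lp_cball M p r"
      using F \<open>0 < r\<close> by (simp add: Lp_cball_def Lp_scale_in_Lp Lp_norm_scale[OF F(1) pos(1)])
    ultimately show ?thesis by blast
  qed
  then show "ereal (r * Lp_norm M q \<Phi>) \<le> (SUP F\<in>Lp_cball M p r. ereal (Lp_pairing M \<Phi> F))"
    by (metis SUP_upper)
qed

lemma inv_opt_cball_iff:
  fixes G :: "('a \<Rightarrow> 'b::banach) set"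
  assumes convex: "uniformly_convex TYPE('b)" and "0 < r"
  shows "\<Phi> \<in> inv_opt M q (Lp_cball M p r) G \<longleftrightarrow>
    \<Phi> \<in> Lp M q \<and> Lp_pairing M \<Phi> G = r * Lp_norm M q \<Phi>"
  using SUP_pairing_cball[OF convex _ \<open>0 < r\<close>] by (auto simp: inv_opt_def)

text \<open>Here \<open>r\<parallel>\<Phi>\<parallel> = \<langle>\<Phi>, G\<rangle> \<le> \<parallel>\<Phi>\<parallel>\<parallel>G\<parallel>\<close> with \<open>\<parallel>G\<parallel> < r\<close>.\<close>

lemma inv_opt_cball_interior:
  fixes G :: "('a \<Rightarrow> 'b::banach) set"
  assumes convex: "uniformly_convex TYPE('b)" and "0 < r" and G: "G \<in> Lp M p" "Lp_norm M p G < r"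
  shows "inv_opt M q (Lp_cball M p r) G \<subseteq> {Lp_zero M}"
proof
  fix \<Phi> assume "\<Phi> \<in> inv_opt M q (Lp_cball M p r) G"
  then have \<Phi>: "\<Phi> \<in> Lp M q" "Lp_pairing M \<Phi> G = r * Lp_norm M q \<Phi>"
    using inv_opt_cball_iff[OF convex \<open>0 < r\<close>] by auto
  have "r * Lp_norm M q \<Phi> \<le> Lp_norm M p G * Lp_norm M q \<Phi>"
    using Holder_pairing[OF G(1) \<Phi>(1)] \<Phi>(2) by (simp add: mult.commute)
  then have "Lp_norm M q \<Phi> = 0"
    using G(2) Lp_norm_nonneg[of q \<Phi>] by (metis mult_right_le_imp_le not_le order_le_less)
  then show "\<Phi> \<in> {Lp_zero M}" using Lp_norm_eq_0_iff[OF \<Phi>(1) pos(2)] by simp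
qed

text \<open>Both \<open>\<Phi>\<close> and the multiple of \<open>J G\<close> of the same norm support \<open>G\<close>, so that they coincide.\<close>

lemma inv_opt_cball_sphere:
  fixes G :: "('a \<Rightarrow> 'b::banach) set"
  assumes convex: "uniformly_convex TYPE('b)" and smooth: "uniformly_smooth TYPE('b)"
    and "0 < r" and G: "G \<in> Lp M p" "Lp_norm M p G = r"
  shows "inv_opt M q (Lp_cball M p r) G = {Lp_scale M t (duality_map M p q G) | t. 0 \<le> t}"
proof (intro set_eqI iffI)
  note J = duality_map[OF smooth G(1), unfolded G(2)]
  fix \<Phi>
  {
    assume "\<Phi> \<in> inv_opt M q (Lp_cball M p r) G"
    then have \<Phi>: "\<Phi> \<in> Lp M q" "Lp_pairing M \<Phi> G = r * Lp_norm M q \<Phi>"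
      using inv_opt_cball_iff[OF convex \<open>0 < r\<close>] by auto
    define t where "t = Lp_norm M q \<Phi> / r"
    have t: "0 \<le> t" unfolding t_def using Lp_norm_nonneg \<open>0 < r\<close> by (rule divide_nonneg_pos)
    have n: "Lp_norm M q (Lp_scale M t (duality_map M p q G)) = Lp_norm M q \<Phi>"
      using t \<open>0 < r\<close> by (simp add: Lp_norm_scale[OF J(1) pos(2)] J(2) t_def Lp_norm_nonneg)
    have "\<Phi> = Lp_scale M t (duality_map M p q G)"
    proof (rule support_functional_unique[OF smooth G(1) _ \<Phi>(1) Lp_scale_in_Lp[OF J(1)]])
      show "Lp_pairing M (Lp_scale M t (duality_map M p q G)) G =
          Lp_norm M q (Lp_scale M t (duality_map M p q G)) * Lp_norm M p G"
        unfolding n using \<open>0 < r\<close>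
        by (simp add: Lp_pairing_scale_left[OF J(1) G(1)] J(3) G(2) t_def power2_eq_square)
    qed (use n G(2) \<open>0 < r\<close> \<Phi>(2) in auto)
    then show "\<Phi> \<in> {Lp_scale M t (duality_map M p q G) | t. 0 \<le> t}" using t by blast
  next
    assume "\<Phi> \<in> {Lp_scale M t (duality_map M p q G) | t. 0 \<le> t}"
    then obtain t where t: "0 \<le> t" "\<Phi> = Lp_scale M t (duality_map M p q G)" by blast
    then show "\<Phi> \<in> inv_opt M q (Lp_cball M p r) G"
      by (simp add: inv_opt_cball_iff[OF convex \<open>0 < r\<close>] Lp_scale_in_Lp[OF J(1)]
          Lp_pairing_scale_left[OF J(1) G(1)] Lp_norm_scale[OF J(1) pos(2)] J(2,3) power2_eq_square)
  }
qed

lemma optimal_cball_iff: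
  fixes G :: "('a \<Rightarrow> 'b::banach) set"
  assumes convex: "uniformly_convex TYPE('b)" and smooth: "uniformly_smooth TYPE('b)"
    and "0 < r" and G: "G \<in> Lp_cball M p r"
  shows "{Lp_zero M} \<subset> inv_opt M q (Lp_cball M p r) G \<longleftrightarrow> Lp_norm M p G = r"
proof
  have G': "G \<in> Lp M p" "Lp_norm M p G \<le> r" using G by (auto simp: Lp_cball_def)
  show "Lp_norm M p G = r" if "{Lp_zero M} \<subset> inv_opt M q (Lp_cball M p r) G"
    using inv_opt_cball_interior[OF convex \<open>0 < r\<close> G'(1)] that G'(2) by force
  assume "Lp_norm M p G = r"
  note J = duality_map[OF smooth G'(1), unfolded this]
  have "duality_map M p q G \<in> inv_opt M q (Lp_cball M p r) G" "Lp_zero M \<in> inv_opt M q (Lp_cball M p r) G"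
    using inv_opt_cball_iff[OF convex \<open>0 < r\<close>, of _ G] J Lp_zero_in_Lp Lp_norm_zero
      Lp_pairing_zero_left[OF G'(1)] by (auto simp: power2_eq_square)
  moreover have "duality_map M p q G \<noteq> Lp_zero M"
  proof
    assume "duality_map M p q G = Lp_zero M"
    then show False using J(2) \<open>0 < r\<close> by (simp add: Lp_norm_zero)
  qed
  ultimately show "{Lp_zero M} \<subset> inv_opt M q (Lp_cball M p r) G" by blast
qed

lemma optimal_points_cball:
  assumes convex: "uniformly_convex TYPE('b::banach)" and smooth: "uniformly_smooth TYPE('b)" and "0 < r"
  shows "optimal_points M q (Lp_cball M p r) = (Lp_sphere M p r :: ('a \<Rightarrow> 'b) set set)"
    and "none_optimal_points M q (Lp_cball M p r) = (Lp_ball M p r :: ('a \<Rightarrow> 'b) set set)"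
proof -
  let ?C = "Lp_cball M p r :: ('a \<Rightarrow> 'b) set set"
  note opt = optimal_cball_iff[OF convex smooth \<open>0 < r\<close>]
  have "optimal_points M q ?C = {G \<in> ?C. Lp_norm M p G = r}"
    unfolding optimal_points_def by (intro Collect_cong conj_cong refl opt)
  also have "\<dots> = Lp_sphere M p r"
    by (auto simp: Lp_cball_def Lp_sphere_def)
  finally show "optimal_points M q ?C = Lp_sphere M p r" .
  have "none_optimal_points M q ?C = {G \<in> ?C. Lp_norm M p G \<noteq> r}"
    unfolding none_optimal_points_def by (intro Collect_cong conj_cong refl arg_cong[where f = Not] opt)
  also have "\<dots> = Lp_ball M p r"
    by (auto simp: Lp_cball_def Lp_ball_def)
  finally show "none_optimal_points M q ?C = Lp_ball M p r" .
qed

text \<open>The set is the preimage under \<open>J\<close> of the ray of \<open>J G\<close>; homogeneity and injectivity of \<open>J\<close> turn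
  it into the ray of \<open>G\<close>.\<close>

lemma inv_opt_star_cball_sphere:
  fixes G :: "('a \<Rightarrow> 'b::banach) set"
  assumes convex: "uniformly_convex TYPE('b)" and smooth: "uniformly_smooth TYPE('b)"
    and "0 < r" and G: "G \<in> Lp M p" "Lp_norm M p G = r"
  shows "inv_opt_star M p q (Lp_cball M p r) G = (\<lambda>t. Lp_scale M t G) ` {0..}"
proof -
  have "H \<in> inv_opt_star M p q (Lp_cball M p r) G \<longleftrightarrow>
      H \<in> Lp M p \<and> duality_map M p q H \<in> inv_opt M q (Lp_cball M p r) G" for H
    using duality_map(1)[OF smooth] by (auto simp: inv_opt_star_def inv_opt_def)
  also have "\<dots> H \<longleftrightarrow> H \<in> Lp M p \<and> (\<exists>t\<ge>0. duality_map M p q H = duality_map M p q (Lp_scale M t G))" for H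
    using inv_opt_cball_sphere[OF convex smooth \<open>0 < r\<close> G] duality_map_scale[OF smooth G(1)] by auto
  also have "\<dots> H \<longleftrightarrow> (\<exists>t\<ge>0. H = Lp_scale M t G)" for H
    using duality_map_inj[OF convex smooth _ Lp_scale_in_Lp[OF G(1)]] Lp_scale_in_Lp[OF G(1)] by blast
  finally show ?thesis by (auto simp: image_iff)
qed

lemma ray_is_curve:
  assumes G: "G \<in> Lp M p"
  shows "curve_from_zero_through M p G ((\<lambda>t. Lp_scale M t G) ` {0..})"
  unfolding curve_from_zero_through_def
proof (intro exI conjI allI impI)
  fix t :: real
  have "((\<lambda>u. \<bar>u - t\<bar> * Lp_norm M p G) \<longlongrightarrow> \<bar>t - t\<bar> * Lp_norm M p G) (at t within {0..})"
    by (intro tendsto_intros)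
  then show "((\<lambda>u. Lp_norm M p (Lp_diff M (Lp_scale M u G) (Lp_scale M t G))) \<longlongrightarrow> 0) (at t within {0..})"
    by (simp add: Lp_scale_diff Lp_norm_scale[OF G pos(1)])
  show "G \<in> (\<lambda>t. Lp_scale M t G) ` {0..}"
    using Lp_scale_one[OF G] by (intro image_eqI[where x = 1]) auto
qed (auto simp: Lp_scale_in_Lp[OF G] Lp_scale_0)

end

theorem theorem5p1:
  fixes M :: "'a measure" and p q r :: real
  assumes "complete_measure M"
    and "uniformly_convex TYPE('b::banach)"
    and "uniformly_smooth TYPE('b)"
    and "1 < p" and "1 < q" and "1 / p + 1 / q = 1"
    and "0 < r"
  shows "none_optimal_points M q (Lp_cball M p r) = (Lp_ball M p r :: ('a \<Rightarrow> 'b) set set)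
    \<and> optimal_points M q (Lp_cball M p r) = (Lp_sphere M p r :: ('a \<Rightarrow> 'b) set set)
    \<and> (\<forall>G \<in> (Lp_sphere M p r :: ('a \<Rightarrow> 'b) set set).
        inv_opt M q (Lp_cball M p r) G = {Lp_scale M t (duality_map M p q G) | t. 0 \<le> t}
        \<and> curve_from_zero_through M p G (inv_opt_star M p q (Lp_cball M p r) G))"
proof -
  interpret conjugate_exponents M p q
    using assms(1,4,5,6) by (simp add: conjugate_exponents_def conjugate_exponents_axioms_def)
  have "inv_opt M q (Lp_cball M p r) G = {Lp_scale M t (duality_map M p q G) | t. 0 \<le> t}
      \<and> curve_from_zero_through M p G (inv_opt_star M p q (Lp_cball M p r) G)"
    if "G \<in> Lp_sphere M p r" for G :: "('a \<Rightarrow> 'b) set"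
  proof -
    have G: "G \<in> Lp M p" "Lp_norm M p G = r" using that by (auto simp: Lp_sphere_def)
    show ?thesis
      using inv_opt_cball_sphere[OF assms(2,3,7) G] inv_opt_star_cball_sphere[OF assms(2,3,7) G]
        ray_is_curve[OF G(1)] by simp
  qed
  then show ?thesis using optimal_points_cball[OF assms(2,3,7)] by blast
qed

end
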